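(* Let $m\ge1$, $\gamma\in(0,1)$, $0<\lambda\le\Lambda$. Let $K$ be a radially symmetric kernel such that $\tau\mapsto K(\sqrt\tau)$ is strictly convex on $(0,+\infty)$ and $L_K\in\mathcal{L}_0(2m,\gamma,\lambda,\Lambda)$. Let $G\in C^2(\mathbb{R})$ be even with $G\ge G(\pm1)=0$ in $\mathbb{R}$. Let $S\ge2$, let $R>S+4$, and let $u\in\widetilde{\mathbb{H}}^K_{0,\mathrm{odd}}(B_R)$ be a doubly radial odd minimizer of $\mathcal{E}$ in $B_R$. Then $$\mathcal{E}(u,B_S)\le\begin{cases}C\,S^{2m-2\gamma}&\text{if }\gamma\in(0,1/2),\\ C\,S^{2m-1}\log S&\text{if }\gamma=1/2,\\ C\,S^{2m-1}&\text{if }\gamma\in(1/2,1),\end{cases}$$ where $C$ is a positive constant depending only on $m$, $\gamma$, $\lambda$, $\Lambda$ and $\|G\|_{C^2([-1,1])}$.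
   Context: Points of $\mathbb{R}^{2m}$ are written $x=(x',x'')\in\mathbb{R}^m\times\mathbb{R}^m$ and $x^\star:=(x'',x')$. A function $w$ is doubly radial if it depends only on $|x'|$ and $|x''|$; a doubly radial $w$ is odd (with respect to the Simons cone $\{|x'|=|x''|\}$) if $w(x)=-w(x^\star)$. $B_R$ is the ball of radius $R$ centered at the origin of $\mathbb{R}^{2m}$. $L_K\in\mathcal{L}_0(n,\gamma,\lambda,\Lambda)$ means $L_Ku(x)=\mathrm{P.V.}\int_{\mathbb{R}^n}\{u(x)-u(y)\}K(x-y)\,dy$ with $K\ge0$, $K(z)=K(-z)$, $\int\min\{|z|^2,1\}K(z)\,dz<\infty$ and $\lambda c_{n,\gamma}|z|^{-n-2\gamma}\le K(z)\le\Lambda c_{n,\gamma}|z|^{-n-2\gamma}$, where $c_{n,\gamma}>0$ is the normalizing constant of $(-\Delta)^\gamma$ in $\mathbb{R}^n$. Radially symmetric means $K(z)=K(|z|)$; strict convexity of $K(\sqrt\cdot)$ means $K(\sqrt{\tau_1})+K(\sqrt{\tau_2})>2K(\sqrt{(\tau_1+\tau_2)/2})$ for all $\tau_1\ne\tau_2$ in $(0,+\infty)$. Energy: for $\Omega\subset\mathbb{R}^{2m}$, $$\mathcal{E}(w,\Omega)=\tfrac14\Big\{\int_\Omega\!\int_\Omega|w(x)-w(y)|^2K(x-y)\,dx\,dy+2\int_\Omega\!\int_{\mathbb{R}^{2m}\setminus\Omega}|w(x)-w(y)|^2K(x-y)\,dx\,dy\Big\}+\int_\Omega G(w)\,dx.$$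 $\widetilde{\mathbb{H}}^K_{0,\mathrm{odd}}(B_R)$ is the space of functions $w:\mathbb{R}^{2m}\to\mathbb{R}$ with $w\in L^2(B_R)$, $w=0$ a.e. in $\mathbb{R}^{2m}\setminus B_R$, $\iint_{(\mathbb{R}^{2m})^2\setminus(\mathbb{R}^{2m}\setminus B_R)^2}|w(x)-w(y)|^2K(x-y)\,dx\,dy<\infty$, which are (a.e.) doubly radial and odd with respect to the Simons cone. A doubly radial odd minimizer of $\mathcal{E}$ in $B_R$ is $u\in\widetilde{\mathbb{H}}^K_{0,\mathrm{odd}}(B_R)$ with $\mathcal{E}(u,B_R)\le\mathcal{E}(w,B_R)$ for every $w\in\widetilde{\mathbb{H}}^K_{0,\mathrm{odd}}(B_R)$. *)

theory Defs
  imports "HOL-Analysis.Analysis"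
begin

text \<open>
  Points of \<open>\<real>\<^sup>2\<^sup>m\<close> are pairs \<open>x = (x', x'')\<close> of type \<open>(real ^ 'm) \<times> (real ^ 'm)\<close> with
  \<open>m = CARD('m)\<close>; the product norm is Euclidean, and \<open>prod.swap x\<close> is the point
  \<open>x\<^sup>\<star> = (x'', x')\<close>.  Measurability and integrals are with respect to \<open>lebesgue\<close>, the completed
  Lebesgue measure.
\<close>

type_synonym 'm pt = "(real ^ 'm) \<times> (real ^ 'm)"


section \<open>Kernels\<close>

text \<open>
  The closed form of the constant \<open>c\<close> for which the operator with kernel \<open>c |z|^(-n-2\<gamma>)\<close> has
  Fourier symbol \<open>|\<xi>|^(2\<gamma>)\<close>.
\<close>

definition frac_laplacian_const :: "nat \<Rightarrow> real \<Rightarrow> real" where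
  "frac_laplacian_const n \<gamma> =
     \<gamma> * 4 powr \<gamma> * Gamma (real n / 2 + \<gamma>) / (pi powr (real n / 2) * Gamma (1 - \<gamma>))"

text \<open>
  The class \<open>\<L>\<^sub>0(n, \<gamma>, \<lambda>, \<Lambda>)\<close> with \<open>n = DIM('a)\<close>, as a condition on the kernel \<open>K\<close> of \<open>L\<^sub>K\<close>.
  The value of \<open>K\<close> at the origin is irrelevant, so the two-sided bound is required
  only away from it (note that \<open>0 powr a = 0\<close>).
\<close>

definition kernel_L0 :: "real \<Rightarrow> real \<Rightarrow> real \<Rightarrow> ('a::euclidean_space \<Rightarrow> real) \<Rightarrow> bool" where
  "kernel_L0 \<gamma> lam Lam K \<longleftrightarrow>
     K \<in> borel_measurable lebesgue \<and>
     (\<forall>z. 0 \<le> K z) \<and>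
     (\<forall>z. K z = K (- z)) \<and>
     integrable lebesgue (\<lambda>z. min ((norm z)\<^sup>2) 1 * K z) \<and>
     (\<forall>z. z \<noteq> 0 \<longrightarrow>
        lam * frac_laplacian_const DIM('a) \<gamma> * norm z powr (- real DIM('a) - 2 * \<gamma>) \<le> K z \<and>
        K z \<le> Lam * frac_laplacian_const DIM('a) \<gamma> * norm z powr (- real DIM('a) - 2 * \<gamma>))"

definition radial_with_profile :: "('a::real_normed_vector \<Rightarrow> real) \<Rightarrow> (real \<Rightarrow> real) \<Rightarrow> bool" where
  "radial_with_profile K \<kappa> \<longleftrightarrow> (\<forall>z. K z = \<kappa> (norm z))"

definition strictly_convex_pos :: "(real \<Rightarrow> real) \<Rightarrow> bool" where
  "strictly_convex_pos f \<longleftrightarrow>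
     (\<forall>\<tau>1>0. \<forall>\<tau>2>0. \<tau>1 \<noteq> \<tau>2 \<longrightarrow> f \<tau>1 + f \<tau>2 > 2 * f ((\<tau>1 + \<tau>2) / 2))"


section \<open>Potentials\<close>

definition C2_real :: "(real \<Rightarrow> real) \<Rightarrow> bool" where
  "C2_real G \<longleftrightarrow>
     (\<forall>x. G field_differentiable at x) \<and>
     (\<forall>x. deriv G field_differentiable at x) \<and>
     continuous_on UNIV (deriv (deriv G))"

definition C2_norm :: "(real \<Rightarrow> real) \<Rightarrow> real" where
  "C2_norm G =
     (SUP t\<in>{-1..1}. \<bar>G t\<bar>) + (SUP t\<in>{-1..1}. \<bar>deriv G t\<bar>) + (SUP t\<in>{-1..1}. \<bar>deriv (deriv G) t\<bar>)"


section \<open>Doubly radial odd functions\<close>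

definition doubly_radial :: "('m::finite pt \<Rightarrow> real) \<Rightarrow> bool" where
  "doubly_radial w \<longleftrightarrow> (\<exists>f. \<forall>x. w x = f (norm (fst x)) (norm (snd x)))"

definition simons_odd :: "('m::finite pt \<Rightarrow> real) \<Rightarrow> bool" where
  "simons_odd w \<longleftrightarrow> (\<forall>x. w x = - w (prod.swap x))"

definition interaction :: "('a::euclidean_space \<Rightarrow> real) \<Rightarrow> ('a \<Rightarrow> real) \<Rightarrow> 'a \<Rightarrow> 'a \<Rightarrow> ennreal" where
  "interaction K w x y = ennreal (\<bar>w x - w y\<bar>\<^sup>2 * K (x - y))"

definition H0_odd :: "('m::finite pt \<Rightarrow> real) \<Rightarrow> real \<Rightarrow> ('m pt \<Rightarrow> real) set" where
  "H0_odd K R = {w.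
     w \<in> borel_measurable (lebesgue_on (ball 0 R)) \<and>
     integrable (lebesgue_on (ball 0 R)) (\<lambda>x. (w x)\<^sup>2) \<and>
     (AE x in lebesgue. x \<notin> ball 0 R \<longrightarrow> w x = 0) \<and>
     (\<integral>\<^sup>+ x. \<integral>\<^sup>+ y. interaction K w x y * indicator (- ((- ball 0 R) \<times> (- ball 0 R))) (x, y)
        \<partial>lebesgue \<partial>lebesgue) < \<infinity> \<and>
     (\<exists>v. doubly_radial v \<and> simons_odd v \<and> (AE x in lebesgue. w x = v x))}"


section \<open>Energy and minimizers\<close>

text \<open>
  The energy takes values in \<open>[0, \<infinity>]\<close>.  It is meant for \<open>K \<ge> 0\<close> and \<open>G \<ge> 0\<close> only: \<open>ennreal\<close>
  truncates negative arguments to zero.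
\<close>

definition energy ::
  "('a::euclidean_space \<Rightarrow> real) \<Rightarrow> (real \<Rightarrow> real) \<Rightarrow> ('a \<Rightarrow> real) \<Rightarrow> 'a set \<Rightarrow> ennreal" where
  "energy K G w \<Omega> =
     ((\<integral>\<^sup>+x\<in>\<Omega>. (\<integral>\<^sup>+y\<in>\<Omega>. interaction K w x y \<partial>lebesgue) \<partial>lebesgue) +
      2 * (\<integral>\<^sup>+x\<in>\<Omega>. (\<integral>\<^sup>+y\<in>- \<Omega>. interaction K w x y \<partial>lebesgue) \<partial>lebesgue)) / 4 +
     (\<integral>\<^sup>+x\<in>\<Omega>. ennreal (G (w x)) \<partial>lebesgue)"

definition doubly_radial_odd_minimizer ::
  "('m::finite pt \<Rightarrow> real) \<Rightarrow> (real \<Rightarrow> real) \<Rightarrow> real \<Rightarrow> ('m pt \<Rightarrow> real) \<Rightarrow> bool" where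
  "doubly_radial_odd_minimizer K G R u \<longleftrightarrow>
     u \<in> H0_odd K R \<and>
     (\<forall>w \<in> H0_odd K R. energy K G u (ball 0 R) \<le> energy K G w (ball 0 R))"

end

theory Submission
  imports Defs
begin

text \<open>
  Let \<open>U\<close> be the minimizer, \<open>\<bar>U\<bar> \<le> 1\<close> by truncation. Near the cone the energy is controlled by a
  Caccioppoli inequality: for a cutoff \<open>\<zeta>\<close> supported in a strip of bounded width around the cone,
  the competitor \<open>(1 - \<zeta>\<^sup>2/2) U\<close> bounds the energy of \<open>\<zeta> U\<close> by the volume of the strip, which is
  of order \<open>S\<close> to the power \<open>2m - 1\<close>. Let \<open>\<phi>\<close> be equal to \<open>U\<close> near the cone and, away from it and on
  the side \<open>|x'| > |x''|\<close>, to \<open>1\<close> for \<open>|x| \<le> S + 1\<close> and to \<open>-1\<close> for \<open>|x| \<ge> S + 2\<close>, with the opposite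
  signs on the other side. The competitor that is \<open>max U \<phi>\<close> on the first side and \<open>min U \<phi>\<close> on the
  other coincides with \<open>U\<close> for \<open>|x| \<ge> S + 2\<close>, and its mirror image (with \<open>max\<close> and \<open>min\<close> exchanged)
  coincides with \<open>U\<close> for \<open>|x| \<le> S + 1\<close>. Submodularity of the energy therefore bounds the energy of
  \<open>U\<close> by that of \<open>\<phi>\<close>. It fails only for pairs of points on opposite sides of the cone, at distance
  at least comparable to their distance from the cone; these pairs, like all long range
  contributions to the energy of \<open>\<phi>\<close>, contribute at most a multiple of
  \<open>\<integral> min (|z|\<^sup>2, 1) min (1 + |z|, S) K(z) dz\<close> times \<open>S\<close> to the power \<open>2m - 1\<close>.
\<close>

section \<open>Radial integrals\<close>

text \<open>Polar coordinates. The image of Lebesgue measure under the norm and the measure with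
  density \<open>n * unit_ball_vol n * r ^ (n - 1)\<close> on \<open>{0..}\<close> agree on every
  \<open>{..b}\<close>, where both give the volume of a ball, and these sets generate the Borel
  sets.\<close>

lemma nn_integral_radial:
  fixes f :: "real \<Rightarrow> ennreal"
  assumes [measurable]: "f \<in> borel_measurable borel"
  shows "(\<integral>\<^sup>+z. f (norm (z::'a::euclidean_space)) \<partial>lborel) =
    (\<integral>\<^sup>+r. ennreal (indicator {0..} r * (real DIM('a) * unit_ball_vol (real DIM('a)) * r ^ (DIM('a) - 1)))
       * f r \<partial>lborel)"
proof -
  define n where "n = DIM('a)"
  have n: "n \<ge> 1" by (simp add: n_def Suc_leI)
  let ?d = "\<lambda>r::real. ennreal (indicator {0..} r * (real n * unit_ball_vol (real n) * r ^ (n - 1)))"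
  have "distr lborel borel (norm :: 'a \<Rightarrow> real) = density lborel ?d" (is "?M = ?N")
  proof (rule measure_eqI_generator_eq[where \<Omega> = UNIV and E = "range atMost" and A = "\<lambda>i. {..real i}"])
    show "Int_stable (range atMost :: real set set)"
      by (auto simp: Int_stable_def)
    fix X :: "real set" assume "X \<in> range atMost"
    then obtain b where X: "X = {..b}" by auto
    have l: "emeasure ?M X = emeasure lborel (cball (0::'a) b)"
      unfolding X by (subst emeasure_distr) (auto intro!: arg_cong[where f="emeasure lborel"])
    have r: "emeasure ?N X = (\<integral>\<^sup>+r. ?d r * indicator {..b} r \<partial>lborel)"
      unfolding X by (subst emeasure_density) auto
    show "emeasure ?M X = emeasure ?N X"
    proof (cases "b \<ge> 0")
      case True
      have "(\<integral>\<^sup>+r. ?d r * indicator {..b} r \<partial>lborel) =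
         (\<integral>\<^sup>+r. ennreal (real n * unit_ball_vol (real n) * r ^ (n - 1)) * indicator {0..b} r \<partial>lborel)"
        by (intro nn_integral_cong) (auto split: split_indicator)
      also have "\<dots> = ennreal (unit_ball_vol (real n) * b ^ n - unit_ball_vol (real n) * 0 ^ n)"
        using True by (intro nn_integral_FTC_Icc) (auto intro!: derivative_eq_intros)
      also have "\<dots> = emeasure lborel (cball (0::'a) b)"
        using n True by (simp add: emeasure_cball n_def)
      finally show ?thesis using l r by simp
    next
      case False
      have "(\<integral>\<^sup>+r. ?d r * indicator {..b} r \<partial>lborel) = (\<integral>\<^sup>+(r::real). 0 \<partial>lborel)"
        using False by (intro nn_integral_cong) (auto split: split_indicator)
      then show ?thesis using l r False by simp
    qed
  next
    have s: "sets borel = sigma_sets UNIV (range (atMost :: real \<Rightarrow> real set))"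
      using borel_eq_atMost[where 'a=real] by (metis sets_measure_of_conv subset_UNIV Pow_UNIV space_borel sets_measure_of)
    show "sets ?M = sigma_sets UNIV (range atMost)" "sets ?N = sigma_sets UNIV (range atMost)"
      using s by simp_all
    show "(\<Union>i. {..real i}) = UNIV" using real_arch_simple by auto
    fix i :: nat
    have "emeasure ?M {..real i} = emeasure lborel (cball (0::'a) (real i))"
      by (subst emeasure_distr) (auto intro!: arg_cong[where f="emeasure lborel"])
    then show "emeasure ?M {..real i} \<noteq> \<infinity>" by (simp add: emeasure_cball)
  qed auto
  then have "(\<integral>\<^sup>+r. f r \<partial>?M) = (\<integral>\<^sup>+r. f r \<partial>?N)" by simp
  then show ?thesis
    by (simp add: nn_integral_distr nn_integral_density n_def)
qed

section \<open>The growth rate and the radial integral that produces it\<close>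

text \<open>The factor multiplying \<open>S ^ (2m - 1)\<close> in the final bound. Up to constants
  it is the integral of \<open>r powr (-2*\<gamma>)\<close> over \<open>{1..S}\<close>.\<close>

definition energy_rate :: "real \<Rightarrow> real \<Rightarrow> real" where
  "energy_rate \<gamma> S = (if \<gamma> < 1 / 2 then S powr (1 - 2 * \<gamma>) else if \<gamma> = 1 / 2 then ln S else 1)"

text \<open>Lets bounded terms be absorbed into a multiple of the rate. The constant is below 1
  because at the critical exponent the rate is \<open>ln S\<close>, which is less than 1 for
  \<open>S = 2\<close>.\<close>

lemma energy_rate_ge:
  assumes "S \<ge> 2" "0 < \<gamma>" shows "energy_rate \<gamma> S \<ge> 1/2"
proof -
  have "ln (2::real) \<ge> 1/2"
    using ln_one_minus_pos_lower_bound[of "1/2"] ln_2_less_1 ln_le_minus_one[of "1/2::real"]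
    by (simp add: ln_div)
  then have "ln S \<ge> 1/2" using assms ln_mono[of 2 S] by linarith
  moreover have "S powr (1 - 2 * \<gamma>) \<ge> 1" if "\<gamma> < 1/2"
    using that assms by (intro ge_one_powr_ge_zero) auto
  ultimately show ?thesis by (auto simp: energy_rate_def)
qed

lemma nn_integral_powr_Icc:
  fixes p a b :: real
  assumes "0 < a" "a \<le> b" "p \<noteq> -1"
  shows "(\<integral>\<^sup>+r. ennreal (r powr p) * indicator {a..b} r \<partial>lborel) =
    ennreal (b powr (p+1) / (p+1) - a powr (p+1) / (p+1))"
  using assms by (intro nn_integral_FTC_Icc) (auto intro!: derivative_eq_intros)

lemma nn_integral_inverse_Icc:
  fixes a b :: real
  assumes "0 < a" "a \<le> b"
  shows "(\<integral>\<^sup>+r. ennreal (r powr -1) * indicator {a..b} r \<partial>lborel) = ennreal (ln b - ln a)"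
  using assms by (intro nn_integral_FTC_Icc)
     (auto intro!: derivative_eq_intros simp: powr_minus field_simps)

lemma nn_integral_powr_atLeast:
  fixes p a :: real
  assumes "0 < a" "p < -1"
  shows "(\<integral>\<^sup>+r. ennreal (r powr p) * indicator {a..} r \<partial>lborel) = ennreal (- (a powr (p+1)) / (p+1))"
proof -
  have "(\<integral>\<^sup>+r. ennreal (r powr p) * indicator {a..} r \<partial>lborel) = ennreal (0 - a powr (p+1) / (p+1))"
  proof (rule nn_integral_FTC_atLeast)
    have "((\<lambda>x. x powr (p+1)) \<longlongrightarrow> 0) at_top"
      using assms by (intro tendsto_neg_powr filterlim_ident) auto
    from tendsto_divide[OF this tendsto_const, of "p+1"]
    show "((\<lambda>x. x powr (p+1) / (p+1)) \<longlongrightarrow> 0) at_top" using assms by simp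
  qed (use assms in \<open>auto intro!: derivative_eq_intros\<close>)
  then show ?thesis by simp
qed

lemma nn_integral_powr_near_zero:
  fixes p :: real
  assumes "-1 < p"
  shows "(\<integral>\<^sup>+r. ennreal (r powr p) * indicator {0..1} r \<partial>lborel) = ennreal (1 / (p+1))"
proof -
  have "((\<lambda>x. x powr p) has_integral 1 / (p+1)) {0..1}"
    using has_integral_powr_from_0[of p 1] assms by simp
  then have "((\<lambda>x. if x \<in> {0..1} then x powr p else 0) has_integral 1 / (p+1)) UNIV"
    by (subst has_integral_restrict_UNIV)
  then have "(\<integral>\<^sup>+r. ennreal (if r \<in> {0..1} then r powr p else 0) \<partial>lborel) = ennreal (1 / (p+1))"
    by (intro nn_integral_has_integral_lborel) auto
  moreover have "(\<integral>\<^sup>+r. ennreal (r powr p) * indicator {0..1} r \<partial>lborel) = (\<integral>\<^sup>+r. ennreal (if r \<in> {0..1} then r powr p else 0) \<partial>lborel)"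
    by (intro nn_integral_cong) (auto split: split_indicator)
  ultimately show ?thesis by simp
qed

lemma set_nn_integral_cmult_real:
  fixes f :: "'a \<Rightarrow> real"
  assumes "0 \<le> c" and [measurable]: "f \<in> borel_measurable M" "A \<in> sets M"
  shows "(\<integral>\<^sup>+x. ennreal (c * f x) * indicator A x \<partial>M) = ennreal c * (\<integral>\<^sup>+x. ennreal (f x) * indicator A x \<partial>M)"
  using assms(1) by (simp add: ennreal_mult' mult.assoc nn_integral_cmult)

text \<open>The first factor bounds, up to a constant, squared increments of bounded Lipschitz
  functions over a displacement of length \<open>r\<close>. The second, times
  \<open>S ^ (2m - 1)\<close>, is the order of the volume on which such increments occur.\<close>

definition truncated_weight :: "real \<Rightarrow> real \<Rightarrow> real" where
  "truncated_weight S r = min (r\<^sup>2) 1 * min (1 + r) S"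

text \<open>Splitting at \<open>1\<close> and \<open>S\<close> leaves multiples of pure powers:
  \<open>r powr (1-2*\<gamma>)\<close> near zero, \<open>r powr (-2*\<gamma>)\<close> in between,
  \<open>S * r powr (-1-2*\<gamma>)\<close> beyond. The middle range produces the three cases of the
  rate, and the outer two are of no larger order.\<close>

lemma nn_integral_weight_1d:
  assumes "0 < \<gamma>" "\<gamma> < 1"
  shows "\<exists>C>0. \<forall>S\<ge>2. (\<integral>\<^sup>+r. ennreal (truncated_weight S r * r powr (-1 - 2*\<gamma>)) * indicator {0..} r \<partial>lborel)
            \<le> ennreal (C * energy_rate \<gamma> S)"
proof -
  \<comment> \<open>\<open>c * energy_rate \<gamma> S\<close> bounds the integral of
    \<open>r powr (-2*\<gamma>)\<close> over \<open>{1..S}\<close>.\<close>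
  define c where "c = (if \<gamma> = 1/2 then 1 else 1 / \<bar>1 - 2*\<gamma>\<bar>)"
  have c: "c > 0" by (auto simp: c_def)
  show ?thesis
  \<comment> \<open>One summand for each range. The value \<open>2/(2-2*\<gamma>)\<close> near zero
    is doubled because the rate is at least \<open>1/2\<close>; the last summand is doubled for the
    same reason.\<close>
  proof (intro exI[of _ "4/(2-2*\<gamma>) + 2*c + 2/(2*\<gamma>)"] conjI allI impI)
    show "4/(2-2*\<gamma>) + 2*c + 2/(2*\<gamma>) > 0" using assms c by (auto intro!: add_pos_pos)
    fix S :: real assume S: "S \<ge> 2"
    let ?F = "energy_rate \<gamma> S"
    have F: "?F \<ge> 1/2" using energy_rate_ge S assms by blast
    let ?f = "\<lambda>r. ennreal (2 * r powr (1-2*\<gamma>)) * indicator {0..1} r"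
    let ?g = "\<lambda>r. ennreal (2 * r powr (-2*\<gamma>)) * indicator {1..S} r"
    let ?h = "\<lambda>r. ennreal (S * r powr (-1-2*\<gamma>)) * indicator {S..} r"
    have "(\<integral>\<^sup>+r. ennreal (truncated_weight S r * r powr (-1 - 2*\<gamma>)) * indicator {0..} r \<partial>lborel) \<le>
        (\<integral>\<^sup>+r. ?f r + ?g r + ?h r \<partial>lborel)"
    proof (rule nn_integral_mono)
      fix r :: real
      consider "r < 0" | "0 \<le> r" "r \<le> 1" | "1 < r" "r \<le> S" | "r > S" by linarith
      then show "ennreal (truncated_weight S r * r powr (-1 - 2*\<gamma>)) * indicator {0..} r \<le> ?f r + ?g r + ?h r"
      proof cases
        case 2
        have "truncated_weight S r * r powr (-1-2*\<gamma>) \<le> 2 * r powr (1-2*\<gamma>)"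
        proof (cases "r = 0")
          case False
          have "truncated_weight S r \<le> r\<^sup>2 * 2"
            unfolding truncated_weight_def using 2 S by (intro mult_mono) auto
          then have "truncated_weight S r * r powr (-1-2*\<gamma>) \<le> 2 * (r powr 2 * r powr (-1-2*\<gamma>))"
            using 2 False by (auto intro!: mult_right_mono simp: powr_numeral)
          then show ?thesis by (simp flip: powr_add)
        qed auto
        then have "ennreal (truncated_weight S r * r powr (-1 - 2*\<gamma>)) * indicator {0..} r \<le> ?f r"
          using 2 by (auto intro!: ennreal_leI)
        then show ?thesis by (meson add_increasing2 zero_le)
      next
        case 3
        have "truncated_weight S r \<le> 2 * r"
          unfolding truncated_weight_def using 3 S by (auto intro!: order_trans[OF mult_mono[of _ 1 _ "2*r"]])
        then have "truncated_weight S r * r powr (-1-2*\<gamma>) \<le> 2 * (r powr 1 * r powr (-1-2*\<gamma>))"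
            using 3 by (auto intro!: mult_right_mono)
        moreover have "r powr 1 * r powr (-1-2*\<gamma>) = r powr (-2*\<gamma>)"
          by (subst powr_add[symmetric]) simp
        ultimately have "truncated_weight S r * r powr (-1-2*\<gamma>) \<le> 2 * r powr (-2*\<gamma>)" by metis
        then have "ennreal (truncated_weight S r * r powr (-1 - 2*\<gamma>)) * indicator {0..} r \<le> ?g r"
          using 3 by (auto intro!: ennreal_leI)
        then show ?thesis by (meson add_increasing add_increasing2 zero_le)
      next
        case 4
        have "truncated_weight S r \<le> S"
          unfolding truncated_weight_def using 4 S by (auto intro!: order_trans[OF mult_mono[of _ 1 _ "S"]])
        then have "truncated_weight S r * r powr (-1-2*\<gamma>) \<le> S * r powr (-1-2*\<gamma>)"
            using 4 by (auto intro!: mult_right_mono)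
        then have "ennreal (truncated_weight S r * r powr (-1 - 2*\<gamma>)) * indicator {0..} r \<le> ?h r"
          using 4 S by (auto intro!: ennreal_leI)
        then show ?thesis by (meson add_increasing zero_le)
      qed auto
    qed
    also have "\<dots> = (\<integral>\<^sup>+r. ?f r \<partial>lborel) + (\<integral>\<^sup>+r. ?g r \<partial>lborel) + (\<integral>\<^sup>+r. ?h r \<partial>lborel)"
      by (simp add: nn_integral_add)
    also have "(\<integral>\<^sup>+r. ?f r \<partial>lborel) = ennreal (2/(2-2*\<gamma>))"
      using nn_integral_powr_near_zero[of "1-2*\<gamma>"] assms
        ennreal_mult'[of 2 "1/(2-2*\<gamma>)", symmetric]
      by (subst set_nn_integral_cmult_real) auto
    also have "(\<integral>\<^sup>+r. ?h r \<partial>lborel) = ennreal (S * S powr (-2*\<gamma>) / (2*\<gamma>))"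
      using nn_integral_powr_atLeast[of S "-1-2*\<gamma>"] assms S
        ennreal_mult'[of S "S powr (-2*\<gamma>)/(2*\<gamma>)", symmetric]
      by (subst set_nn_integral_cmult_real) auto
    also have "(\<integral>\<^sup>+r. ?g r \<partial>lborel) \<le> ennreal (2 * c * ?F)"
    proof (cases "\<gamma> = 1/2")
      case True
      have "(\<integral>\<^sup>+r. ?g r \<partial>lborel) = 2 * (\<integral>\<^sup>+r. ennreal (r powr -1) * indicator {1..S} r \<partial>lborel)"
      proof -
        have e: "-2*\<gamma> = -1" using True by simp
        show ?thesis unfolding e by (subst set_nn_integral_cmult_real) auto
      qed
      also have "\<dots> = ennreal (2 * ln S)"
        using nn_integral_inverse_Icc[of 1 S] S by (simp add: ennreal_mult')
      finally have "(\<integral>\<^sup>+r. ?g r \<partial>lborel) = ennreal (2 * ln S)" .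
      moreover have "2 * c * ?F = 2 * ln S" using True by (simp add: c_def energy_rate_def)
      ultimately show ?thesis by (simp only: order_refl)
    next
      case False
      have "(\<integral>\<^sup>+r. ?g r \<partial>lborel) = 2 * (\<integral>\<^sup>+r. ennreal (r powr (-2*\<gamma>)) * indicator {1..S} r \<partial>lborel)"
        by (subst set_nn_integral_cmult_real) auto
      also have "\<dots> = 2 * ennreal (S powr (1-2*\<gamma>) / (1-2*\<gamma>) - 1 / (1-2*\<gamma>))"
        using nn_integral_powr_Icc[of 1 S "-2*\<gamma>"] S False by simp
      also have "\<dots> \<le> ennreal (2 * c * ?F)"
      proof -
        have "S powr (1-2*\<gamma>) / (1-2*\<gamma>) - 1 / (1-2*\<gamma>) \<le> c * ?F"
        proof (cases "\<gamma> < 1/2")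
          case True
          then have "0 \<le> 1 / (1 - 2*\<gamma>)" by simp
          then show ?thesis using True by (simp add: c_def energy_rate_def)
        next
          case F: False
          have *: "0 \<le> S powr (1-2*\<gamma>) / (2*\<gamma>-1)" using F by simp
          have "S powr (1-2*\<gamma>) / (1-2*\<gamma>) - 1 / (1-2*\<gamma>) = 1/(2*\<gamma>-1) - S powr (1-2*\<gamma>) / (2*\<gamma>-1)"
            using F False by (simp add: divide_simps) (simp add: algebra_simps)
          also have "\<dots> \<le> 1/(2*\<gamma>-1)" using * by linarith
          finally show ?thesis using F False by (simp add: c_def energy_rate_def)
        qed
        then have "2 * ennreal (S powr (1-2*\<gamma>) / (1-2*\<gamma>) - 1 / (1-2*\<gamma>)) \<le> 2 * ennreal (c * ?F)"
          by (intro mult_left_mono ennreal_leI) auto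
        then show ?thesis by (simp add: ennreal_mult' mult.assoc)
      qed
      finally show ?thesis .
    qed
    also have "S * S powr (-2*\<gamma>) / (2*\<gamma>) \<le> 2 / (2*\<gamma>) * ?F"
    proof -
      have "S * S powr (-2*\<gamma>) = S powr (1-2*\<gamma>)" using S powr_add[of S 1 "-2*\<gamma>"] by simp
      moreover have "S powr (1-2*\<gamma>) \<le> 2 * ?F"
      proof (cases "\<gamma> < 1/2")
        case True then show ?thesis by (simp add: energy_rate_def)
      next
        case False
        then have "S powr (1-2*\<gamma>) \<le> S powr 0" using S by (intro powr_mono) auto
        then show ?thesis using F S by simp
      qed
      ultimately have "S * S powr (-2*\<gamma>) / (2*\<gamma>) \<le> (2 * ?F) / (2*\<gamma>)"
        using assms by (intro divide_right_mono) auto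
      then show ?thesis by simp
    qed
    also have "ennreal (2/(2-2*\<gamma>)) \<le> ennreal (4/(2-2*\<gamma>) * ?F)"
    proof (rule ennreal_leI)
      have "2/(2-2*\<gamma>) = 4/(2-2*\<gamma>) * (1/2)" using assms by (simp add: divide_simps)
      also have "\<dots> \<le> 4/(2-2*\<gamma>) * ?F" using F assms by (intro mult_left_mono) auto
      finally show "2/(2-2*\<gamma>) \<le> 4/(2-2*\<gamma>) * ?F" .
    qed
    finally have "(\<integral>\<^sup>+r. ennreal (truncated_weight S r * r powr (-1 - 2*\<gamma>)) * indicator {0..} r \<partial>lborel) \<le>
      ennreal (4/(2-2*\<gamma>) * ?F) + ennreal (2 * c * ?F) + ennreal (2 / (2*\<gamma>) * ?F)"
      by (auto simp: add_mono ennreal_leI)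
    also have "\<dots> = ennreal ((4/(2-2*\<gamma>) + 2*c + 2/(2*\<gamma>)) * ?F)"
      using F assms c by (simp flip: ennreal_plus add: algebra_simps)
    finally show "(\<integral>\<^sup>+r. ennreal (truncated_weight S r * r powr (-1 - 2*\<gamma>)) * indicator {0..} r \<partial>lborel) \<le>
       ennreal ((4/(2-2*\<gamma>) + 2*c + 2/(2*\<gamma>)) * ?F)" .
  qed
qed

text \<open>In polar coordinates \<open>r ^ (n-1)\<close> cancels the dimension in the exponent of
  the kernel, so the order of growth is that of the one-dimensional integral.\<close>

lemma nn_integral_weight:
  assumes "0 < \<gamma>" "\<gamma> < 1"
  shows "\<exists>C>0. \<forall>S\<ge>2. (\<integral>\<^sup>+z. ennreal (truncated_weight S (norm (z::'a::euclidean_space))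
            * norm z powr (- real DIM('a) - 2*\<gamma>)) \<partial>lborel) \<le> ennreal (C * energy_rate \<gamma> S)"
proof -
  define n where "n = DIM('a)"
  have n: "n \<ge> 1" by (simp add: n_def Suc_leI)
  define k where "k = real n * unit_ball_vol (real n)"
  have k: "k > 0" using n by (auto simp: k_def intro!: mult_pos_pos)
  obtain C where C: "C > 0" "\<And>S. S \<ge> 2 \<Longrightarrow> (\<integral>\<^sup>+r. ennreal (truncated_weight S r * r powr (-1 - 2*\<gamma>)) * indicator {0..} r \<partial>lborel)
            \<le> ennreal (C * energy_rate \<gamma> S)"
    using nn_integral_weight_1d[OF assms] by blast
  show ?thesis
  proof (intro exI[of _ "k * C"] conjI allI impI)
    show "k * C > 0" using C k by simp
    fix S :: real assume S: "S \<ge> 2"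
    let ?W = "\<lambda>r. truncated_weight S r"
    have [measurable]: "?W \<in> borel_measurable borel" unfolding truncated_weight_def by measurable
    have "(\<integral>\<^sup>+z. ennreal (?W (norm (z::'a)) * norm z powr (- real n - 2*\<gamma>)) \<partial>lborel) =
      (\<integral>\<^sup>+r. ennreal (indicator {0..} r * (k * r ^ (n-1))) * ennreal (?W r * r powr (- real n - 2*\<gamma>)) \<partial>lborel)"
      using nn_integral_radial[of "\<lambda>r. ennreal (?W r * r powr (- real n - 2*\<gamma>))", where 'a='a]
      by (simp add: n_def k_def)
    also have "\<dots> = (\<integral>\<^sup>+r. ennreal k * (ennreal (?W r * r powr (-1 - 2*\<gamma>)) * indicator {0..} r) \<partial>lborel)"
    proof (rule nn_integral_cong)
      fix r :: real
      show "ennreal (indicator {0..} r * (k * r ^ (n-1))) * ennreal (?W r * r powr (- real n - 2*\<gamma>)) =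
         ennreal k * (ennreal (?W r * r powr (-1 - 2*\<gamma>)) * indicator {0..} r)"
      proof (cases "r > 0")
        case True
        have "r ^ (n-1) = r powr (real n - 1)" using True n by (simp add: powr_realpow[symmetric] of_nat_diff)
        then have "r ^ (n-1) * r powr (- real n - 2*\<gamma>) = r powr (-1 - 2*\<gamma>)"
          by (simp flip: powr_add)
        then have "(k * r ^ (n-1)) * (?W r * r powr (- real n - 2*\<gamma>)) = k * (?W r * r powr (-1 - 2*\<gamma>))"
          by (metis mult.assoc mult.left_commute)
        then have "ennreal (k * r ^ (n-1)) * ennreal (?W r * r powr (- real n - 2*\<gamma>)) =
            ennreal k * ennreal (?W r * r powr (-1 - 2*\<gamma>))"
          using True k by (simp only: ennreal_mult'[symmetric] mult_nonneg_nonneg zero_le_power less_imp_le)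
        then show ?thesis using True by simp
      next
        case False then show ?thesis by (cases "r = 0") auto
      qed
    qed
    also have "\<dots> = ennreal k * (\<integral>\<^sup>+r. ennreal (?W r * r powr (-1 - 2*\<gamma>)) * indicator {0..} r \<partial>lborel)"
      by (intro nn_integral_cmult) measurable
    also have "\<dots> \<le> ennreal k * ennreal (C * energy_rate \<gamma> S)"
      by (intro mult_left_mono C S) auto
    also have "\<dots> = ennreal (k * C * energy_rate \<gamma> S)" using k by (simp add: ennreal_mult' mult.assoc)
    finally show "(\<integral>\<^sup>+z. ennreal (?W (norm (z::'a)) * norm z powr (- real DIM('a) - 2*\<gamma>)) \<partial>lborel)
       \<le> ennreal (k * C * energy_rate \<gamma> S)" by (simp add: n_def)
  qed
qed

text \<open>The maximum covers the empty shell \<open>s > T\<close>. A negative \<open>s\<close> is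
  allowed, since the inner radius \<open>S + 1 - norm z\<close> of later shells may be
  negative.\<close>

lemma emeasure_shell_le:
  assumes "0 \<le> T"
  shows "emeasure lborel {x::'a::euclidean_space. s \<le> norm x \<and> norm x \<le> T} \<le>
     ennreal (real DIM('a) * unit_ball_vol (real DIM('a)) * max 0 (T - s) * T ^ (DIM('a) - 1))"
proof -
  let ?n = "DIM('a)" and ?k = "real DIM('a) * unit_ball_vol (real DIM('a))"
  have "emeasure lborel {x::'a. s \<le> norm x \<and> norm x \<le> T} = (\<integral>\<^sup>+x. indicator {s..T} (norm (x::'a)) \<partial>lborel)"
  proof -
    have "(\<integral>\<^sup>+x. indicator {s..T} (norm (x::'a)) \<partial>lborel) =
        (\<integral>\<^sup>+x. indicator {x::'a. s \<le> norm x \<and> norm x \<le> T} x \<partial>lborel)"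
      by (intro nn_integral_cong) (auto split: split_indicator)
    then show ?thesis by simp
  qed
  also have "\<dots> = (\<integral>\<^sup>+r. ennreal (indicator {0..} r * (?k * r ^ (?n - 1))) * indicator {s..T} r \<partial>lborel)"
    by (rule nn_integral_radial) auto
  also have "\<dots> \<le> (\<integral>\<^sup>+r. ennreal (?k * T ^ (?n - 1)) * indicator {s..T} r \<partial>lborel)"
    by (intro nn_integral_mono)
       (auto split: split_indicator intro!: mult_left_mono power_mono ennreal_leI)
  also have "\<dots> = ennreal (?k * T ^ (?n - 1)) * emeasure lborel {s..T}"
    by (simp add: nn_integral_cmult)
  also have "emeasure lborel {s..T} = ennreal (max 0 (T - s))"
    by (simp add: emeasure_lborel_Icc_eq max_def)
  also have "ennreal (?k * T ^ (?n - 1)) * ennreal (max 0 (T - s)) = ennreal (?k * max 0 (T - s) * T ^ (?n - 1))"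
    using assms by (simp flip: ennreal_mult' add: mult_ac)
  finally show ?thesis .
qed

section \<open>Interaction energies of symmetric kernels\<close>

lemma nn_integral_lborel_reflect:
  fixes x :: "'a::euclidean_space"
  assumes [measurable]: "f \<in> borel_measurable borel"
  shows "(\<integral>\<^sup>+y. f (x - y) \<partial>lborel) = (\<integral>\<^sup>+z. f z \<partial>lborel)"
  by (subst (2) lborel_affine[of "-1" x]) (simp_all add: nn_integral_density nn_integral_distr)

text \<open>Turns almost-everywhere facts about \<open>K z\<close> into facts about
  \<open>K (x - y)\<close> for each fixed \<open>x\<close>.\<close>

lemma AE_lborel_reflect:
  fixes x :: "'a::euclidean_space"
  assumes "AE z in lborel. P z"
  shows "AE y in lborel. P (x - y)"
proof -
  obtain N where N: "N \<in> null_sets lborel" "{z. \<not> P z} \<subseteq> N"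
    using assms by (auto elim!: AE_E simp: null_sets_def)
  then have [measurable]: "N \<in> sets borel" by auto
  have "emeasure lborel {y. x - y \<in> N} = (\<integral>\<^sup>+y. indicator {y. x - y \<in> N} y \<partial>lborel)"
    by simp
  also have "\<dots> = (\<integral>\<^sup>+y. indicator N (x - y) \<partial>lborel)"
    by (intro nn_integral_cong) (auto split: split_indicator)
  also have "\<dots> = (\<integral>\<^sup>+y. indicator N y \<partial>lborel)"
    by (rule nn_integral_lborel_reflect) measurable
  also have "\<dots> = 0" using N by auto
  finally have "{y. x - y \<in> N} \<in> null_sets lborel" by (auto simp: null_sets_def)
  then show ?thesis using N by (auto intro!: AE_I')
qed

section \<open>Positivity of the constant and Borel representatives of kernels\<close>

lemma frac_laplacian_const_pos:
  assumes "0 < \<gamma>" "\<gamma> < 1" shows "0 < frac_laplacian_const n \<gamma>"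
  unfolding frac_laplacian_const_def using assms
  by (intro divide_pos_pos mult_pos_pos Gamma_real_pos) (auto intro: add_nonneg_pos)

text \<open>A Borel function equal to \<open>K\<close> almost everywhere need be neither even nor
  bounded by the power. Setting it to zero on an exceptional null set, on the reflection of that set
  and at the origin restores nonnegativity, evenness and the upper bound at every point; strict
  positivity survives almost everywhere.\<close>

lemma kernel_L0_borel_representative:
  fixes K :: "'a::euclidean_space \<Rightarrow> real"
  assumes K: "kernel_L0 \<gamma> lam Lam K" and par: "0 < \<gamma>" "\<gamma> < 1" "0 < lam" "lam \<le> Lam"
  obtains k where "k \<in> borel_measurable borel" "\<And>z. 0 \<le> k z" "\<And>z. k (- z) = k z"
    "\<And>z. k z \<le> Lam * frac_laplacian_const DIM('a) \<gamma> * norm z powr (- real DIM('a) - 2 * \<gamma>)"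
    "AE z in lborel. K z = k z" "AE z in lborel. 0 < k z"
proof -
  let ?c = "frac_laplacian_const DIM('a) \<gamma>"
  have c: "?c > 0" using par frac_laplacian_const_pos by blast
  have Km: "K \<in> borel_measurable lebesgue" and K0: "\<And>z. 0 \<le> K z" and Ks: "\<And>z. K (- z) = K z"
    and Kl: "\<And>z. z \<noteq> 0 \<Longrightarrow> lam * ?c * norm z powr (- real DIM('a) - 2 * \<gamma>) \<le> K z"
    and Ku: "\<And>z. z \<noteq> 0 \<Longrightarrow> K z \<le> Lam * ?c * norm z powr (- real DIM('a) - 2 * \<gamma>)"
    using K by (auto simp: kernel_L0_def)
  obtain K1 where K1[measurable]: "K1 \<in> borel_measurable borel" and "AE z in lborel. K z = K1 z"
    using completion_ex_borel_measurable_real[OF Km] by auto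
  then have "AE z in lborel. K z = K1 z \<and> K (0 - z) = K1 (0 - z)"
    using AE_lborel_reflect[of "\<lambda>z. K z = K1 z" 0] by auto
  then obtain N where "{z \<in> space lborel. \<not> (K z = K1 z \<and> K (0 - z) = K1 (0 - z))} \<subseteq> N"
      "emeasure lborel N = 0" "N \<in> sets lborel"
    by (rule AE_E)
  then have N: "N \<in> null_sets lborel" "{z. \<not> (K z = K1 z \<and> K (0 - z) = K1 (0 - z))} \<subseteq> N"
    by auto
  have [measurable]: "N \<in> sets borel" using N by auto
  have AN: "AE z in lborel. z \<notin> N" using N AE_not_in by blast
  have AN': "AE z in lborel. - z \<notin> N" using AE_lborel_reflect[OF AN, of 0] by simp
  have A0: "AE z in lborel. z \<noteq> (0::'a)"
    by (auto intro!: AE_I'[of "{0}"])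
  define k where "k z = (if z \<in> N \<or> - z \<in> N \<or> z = 0 then 0 else K1 z)" for z
  have kK: "k z = K z" if "z \<notin> N" "- z \<notin> N" "z \<noteq> 0" for z
  proof -
    have "K z = K1 z" using that N(2) by blast
    then show ?thesis using that by (simp add: k_def)
  qed
  have kz: "k z = 0" if "\<not> (z \<notin> N \<and> - z \<notin> N \<and> z \<noteq> 0)" for z
    using that by (auto simp: k_def)
  show ?thesis
  proof
    show "k \<in> borel_measurable borel" unfolding k_def by measurable
    show "0 \<le> k z" for z using kK[of z] kz[of z] K0[of z] by fastforce
    show "k (- z) = k z" for z using kK[of z] kz[of z] kK[of "-z"] kz[of "-z"] Ks[of z] by fastforce
    show "k z \<le> Lam * ?c * norm z powr (- real DIM('a) - 2 * \<gamma>)" for z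
    proof (cases "z \<notin> N \<and> - z \<notin> N \<and> z \<noteq> 0")
      case True then show ?thesis using kK Ku by auto
    next
      case False then show ?thesis using kz[of z] c par by auto
    qed
    show "AE z in lborel. K z = k z" using AN AN' A0 by eventually_elim (use kK in auto)
    show "AE z in lborel. 0 < k z" using AN AN' A0
    proof eventually_elim
      case (elim z)
      have "0 < lam * ?c * norm z powr (- real DIM('a) - 2 * \<gamma>)" using elim c par by auto
      also have "\<dots> \<le> k z" using Kl[of z] kK[of z] elim by auto
      finally show ?case .
    qed
  qed
qed

lemma ennreal_two_times_divide_4: "2 * X / 4 = (X::ennreal) / 2"
proof -
  have "ennreal 2 / ennreal 4 = ennreal 1 / ennreal 2" by (subst (1 2) divide_ennreal) auto
  then have "(2::ennreal) / 4 = 1 / 2" by simp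
  then show ?thesis by (metis ennreal_times_divide mult.commute mult.right_neutral)
qed

locale symmetric_kernel =
  fixes k :: "'a::euclidean_space \<Rightarrow> real"
  assumes measurable_kernel [measurable]: "k \<in> borel_measurable borel"
    and kernel_nonneg [simp]: "0 \<le> k z"
    and kernel_minus [simp]: "k (- z) = k z"
begin

lemma kernel_commute: "k (x - y) = k (y - x)"
  using kernel_minus[of "x - y"] by simp

text \<open>Values in \<open>ennreal\<close> allow comparisons before finiteness is known. Negative
  values of \<open>F\<close> count as zero, so additivity is stated for nonnegative
  integrands.\<close>

definition kernel_integral :: "('a \<Rightarrow> 'a \<Rightarrow> real) \<Rightarrow> ennreal" where
  "kernel_integral F = (\<integral>\<^sup>+x. \<integral>\<^sup>+y. ennreal (F x y * k (x - y)) \<partial>lborel \<partial>lborel)"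

lemma kernel_integral_mono:
  "(\<And>x y. F x y \<le> H x y) \<Longrightarrow> kernel_integral F \<le> kernel_integral H"
  unfolding kernel_integral_def by (intro nn_integral_mono ennreal_leI mult_right_mono) auto

lemma kernel_integral_add:
  assumes [measurable]: "case_prod F \<in> borel_measurable (borel \<Otimes>\<^sub>M borel)"
      "case_prod H \<in> borel_measurable (borel \<Otimes>\<^sub>M borel)"
    and nn: "\<And>x y. 0 \<le> F x y" "\<And>x y. 0 \<le> H x y"
  shows "kernel_integral (\<lambda>x y. F x y + H x y) = kernel_integral F + kernel_integral H"
proof -
  have "kernel_integral (\<lambda>x y. F x y + H x y) =
    (\<integral>\<^sup>+x. \<integral>\<^sup>+y. ennreal (F x y * k (x - y)) + ennreal (H x y * k (x - y)) \<partial>lborel \<partial>lborel)"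
    unfolding kernel_integral_def using nn
    by (intro nn_integral_cong) (simp add: distrib_right)
  also have "\<dots> = (\<integral>\<^sup>+x. (\<integral>\<^sup>+y. ennreal (F x y * k (x - y)) \<partial>lborel) +
      (\<integral>\<^sup>+y. ennreal (H x y * k (x - y)) \<partial>lborel) \<partial>lborel)"
    by (intro nn_integral_cong nn_integral_add) measurable
  also have "\<dots> = kernel_integral F + kernel_integral H"
    unfolding kernel_integral_def by (intro nn_integral_add) measurable
  finally show ?thesis .
qed

lemma kernel_integral_cmult:
  assumes [measurable]: "case_prod F \<in> borel_measurable (borel \<Otimes>\<^sub>M borel)" and "0 \<le> c"
  shows "kernel_integral (\<lambda>x y. c * F x y) = ennreal c * kernel_integral F"
proof -
  have "kernel_integral (\<lambda>x y. c * F x y) =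
    (\<integral>\<^sup>+x. \<integral>\<^sup>+y. ennreal c * ennreal (F x y * k (x - y)) \<partial>lborel \<partial>lborel)"
    unfolding kernel_integral_def using assms
    by (intro nn_integral_cong) (simp add: ennreal_mult' mult.assoc)
  also have "\<dots> = (\<integral>\<^sup>+x. ennreal c * (\<integral>\<^sup>+y. ennreal (F x y * k (x - y)) \<partial>lborel) \<partial>lborel)"
    by (intro nn_integral_cong nn_integral_cmult) measurable
  also have "\<dots> = ennreal c * kernel_integral F"
    unfolding kernel_integral_def by (intro nn_integral_cmult) measurable
  finally show ?thesis .
qed

lemma kernel_integral_swap:
  assumes [measurable]: "case_prod F \<in> borel_measurable (borel \<Otimes>\<^sub>M borel)"
  shows "kernel_integral (\<lambda>x y. F y x) = kernel_integral F"
proof -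
  have "kernel_integral (\<lambda>x y. F y x) = (\<integral>\<^sup>+x. \<integral>\<^sup>+y. ennreal (F y x * k (y - x)) \<partial>lborel \<partial>lborel)"
    unfolding kernel_integral_def by (subst kernel_commute) simp
  also have "\<dots> = kernel_integral F"
    unfolding kernel_integral_def by (rule lborel_pair.Fubini') measurable
  finally show ?thesis .
qed

text \<open>After the substitution \<open>z = x - y\<close> and Tonelli's theorem, only the volume
  of the set of \<open>x\<close> that contribute for a given displacement \<open>z\<close>
  matters.\<close>

lemma kernel_integral_le_sections:
  assumes [measurable]: "case_prod F \<in> borel_measurable (borel \<Otimes>\<^sub>M borel)"
    and N: "\<And>z. N z \<in> sets borel" and h: "\<And>z. 0 \<le> h z"
    and le: "\<And>x z. F x (x - z) \<le> h z * indicator (N z) x"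
    and V: "\<And>z. emeasure lborel (N z) \<le> V z"
  shows "kernel_integral F \<le> (\<integral>\<^sup>+z. ennreal (h z * k z) * V z \<partial>lborel)"
proof -
  have "kernel_integral F = (\<integral>\<^sup>+x. \<integral>\<^sup>+y. ennreal (F x (x - (x - y)) * k (x - y)) \<partial>lborel \<partial>lborel)"
    unfolding kernel_integral_def by simp
  also have "\<dots> = (\<integral>\<^sup>+x. \<integral>\<^sup>+z. ennreal (F x (x - z) * k z) \<partial>lborel \<partial>lborel)"
    by (intro nn_integral_cong nn_integral_lborel_reflect[where f="\<lambda>z. ennreal (F _ (_ - z) * k z)"]) measurable
  also have "\<dots> = (\<integral>\<^sup>+z. \<integral>\<^sup>+x. ennreal (F x (x - z) * k z) \<partial>lborel \<partial>lborel)"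
    by (rule lborel_pair.Fubini'[symmetric]) measurable
  also have "\<dots> \<le> (\<integral>\<^sup>+z. \<integral>\<^sup>+x. ennreal (h z * k z) * indicator (N z) x \<partial>lborel \<partial>lborel)"
  proof (intro nn_integral_mono)
    fix z x
    have "F x (x - z) * k z \<le> h z * indicator (N z) x * k z" by (intro mult_right_mono le) auto
    then have "ennreal (F x (x - z) * k z) \<le> ennreal (h z * indicator (N z) x * k z)" by (rule ennreal_leI)
    also have "\<dots> = ennreal (h z * k z) * indicator (N z) x" by (auto split: split_indicator)
    finally show "ennreal (F x (x - z) * k z) \<le> ennreal (h z * k z) * indicator (N z) x" .
  qed
  also have "\<dots> = (\<integral>\<^sup>+z. ennreal (h z * k z) * emeasure lborel (N z) \<partial>lborel)"
    using N by (intro nn_integral_cong) (simp add: nn_integral_cmult)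
  also have "\<dots> \<le> (\<integral>\<^sup>+z. ennreal (h z * k z) * V z \<partial>lborel)"
    by (intro nn_integral_mono mult_left_mono V) auto
  finally show ?thesis .
qed

text \<open>Replaces \<open>K\<close> and \<open>u\<close> by Borel functions equal to them almost
  everywhere, for which Tonelli's theorem is available.\<close>

lemma nn_integral_interaction:
  assumes [measurable]: "U \<in> borel_measurable borel" "Q \<in> sets (borel \<Otimes>\<^sub>M borel)"
    and KAE: "AE z in lborel. K z = k z" and uAE: "AE x in lborel. u x = U x"
  shows "(\<integral>\<^sup>+x. \<integral>\<^sup>+y. interaction K u x y * indicator Q (x, y) \<partial>lebesgue \<partial>lebesgue) =
    kernel_integral (\<lambda>x y. indicator Q (x, y) * (U x - U y)\<^sup>2)"
proof -
  have "(\<integral>\<^sup>+x. \<integral>\<^sup>+y. interaction K u x y * indicator Q (x, y) \<partial>lebesgue \<partial>lebesgue) =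
    (\<integral>\<^sup>+x. \<integral>\<^sup>+y. interaction K u x y * indicator Q (x, y) \<partial>lborel \<partial>lborel)"
    by (simp add: nn_integral_completion)
  also have "\<dots> = kernel_integral (\<lambda>x y. indicator Q (x, y) * (U x - U y)\<^sup>2)"
    unfolding kernel_integral_def using uAE
  proof (intro nn_integral_cong_AE, eventually_elim)
    case (elim x)
    have "AE y in lborel. K (x - y) = k (x - y)" using AE_lborel_reflect[OF KAE] by blast
    then have "AE y in lborel. interaction K u x y * indicator Q (x, y) =
        ennreal (indicator Q (x, y) * (U x - U y)\<^sup>2 * k (x - y))"
      using uAE by eventually_elim (auto simp: interaction_def elim split: split_indicator)
    then show ?case by (rule nn_integral_cong_AE)
  qed
  finally show ?thesis .
qed

lemma set_nn_integral_interaction: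
  assumes "U \<in> borel_measurable borel" and [measurable]: "A \<in> sets borel" "B \<in> sets borel"
    and "AE z in lborel. K z = k z" "AE x in lborel. u x = U x"
  shows "(\<integral>\<^sup>+x\<in>A. (\<integral>\<^sup>+y\<in>B. interaction K u x y \<partial>lebesgue) \<partial>lebesgue) =
    kernel_integral (\<lambda>x y. indicator (A \<times> B) (x, y) * (U x - U y)\<^sup>2)"
proof -
  have "(\<integral>\<^sup>+x\<in>A. (\<integral>\<^sup>+y\<in>B. interaction K u x y \<partial>lebesgue) \<partial>lebesgue) =
    (\<integral>\<^sup>+x. \<integral>\<^sup>+y. interaction K u x y * indicator (A \<times> B) (x, y) \<partial>lebesgue \<partial>lebesgue)"
    by (intro nn_integral_cong) (auto split: split_indicator intro!: nn_integral_cong)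
  also have "\<dots> = kernel_integral (\<lambda>x y. indicator (A \<times> B) (x, y) * (U x - U y)\<^sup>2)"
    using assms by (intro nn_integral_interaction) auto
  finally show ?thesis .
qed

lemma potential_eq:
  assumes "AE x in lborel. u x = U x"
  shows "(\<integral>\<^sup>+x\<in>\<Omega>. ennreal (G (u x)) \<partial>lebesgue) = (\<integral>\<^sup>+x\<in>\<Omega>. ennreal (G (U x)) \<partial>lborel)"
  unfolding nn_integral_completion
  by (intro nn_integral_cong_AE) (use assms in auto)

text \<open>Pairs with both points outside \<open>\<Omega>\<close> contribute nothing, because
  \<open>U\<close> vanishes there. By symmetry mixed pairs occur twice in the integral over the
  whole space, which matches the factor 2 in the energy.\<close>

lemma energy_eq:
  assumes U[measurable]: "U \<in> borel_measurable borel" and [measurable]: "\<Omega> \<in> sets borel"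
    and AE: "AE z in lborel. K z = k z" "AE x in lborel. u x = U x"
    and out: "\<And>x. x \<notin> \<Omega> \<Longrightarrow> U x = 0"
  shows "energy K G u \<Omega> = kernel_integral (\<lambda>x y. (U x - U y)\<^sup>2) / 4 +
    (\<integral>\<^sup>+x\<in>\<Omega>. ennreal (G (U x)) \<partial>lborel)"
proof -
  let ?F = "\<lambda>A x y. indicator A (x, y) * (U x - U y)\<^sup>2"
  have m: "case_prod (?F A) \<in> borel_measurable (borel \<Otimes>\<^sub>M borel)"
    if [measurable]: "A \<in> sets (borel \<Otimes>\<^sub>M borel)" for A by measurable
  have msum: "case_prod (\<lambda>x y. ?F (\<Omega> \<times> \<Omega>) x y + ?F (\<Omega> \<times> - \<Omega>) x y) \<in> borel_measurable (borel \<Otimes>\<^sub>M borel)"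
    by measurable
  have mswap: "case_prod (\<lambda>x y. ?F (\<Omega> \<times> - \<Omega>) y x) \<in> borel_measurable (borel \<Otimes>\<^sub>M borel)"
    by measurable
  have "kernel_integral (\<lambda>x y. (U x - U y)\<^sup>2) =
    kernel_integral (\<lambda>x y. (?F (\<Omega> \<times> \<Omega>) x y + ?F (\<Omega> \<times> - \<Omega>) x y) + ?F (\<Omega> \<times> - \<Omega>) y x)"
    by (intro arg_cong[of _ _ kernel_integral] ext)
       (auto split: split_indicator simp: out power2_commute)
  also have "\<dots> = kernel_integral (?F (\<Omega> \<times> \<Omega>)) + kernel_integral (?F (\<Omega> \<times> - \<Omega>)) +
      kernel_integral (\<lambda>x y. ?F (\<Omega> \<times> - \<Omega>) y x)"
    using kernel_integral_add[OF msum mswap] kernel_integral_add[OF m[of "\<Omega> \<times> \<Omega>"] m[of "\<Omega> \<times> - \<Omega>"]]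
    by simp
  also have "kernel_integral (\<lambda>x y. ?F (\<Omega> \<times> - \<Omega>) y x) = kernel_integral (?F (\<Omega> \<times> - \<Omega>))"
    by (rule kernel_integral_swap) measurable
  finally have "kernel_integral (\<lambda>x y. (U x - U y)\<^sup>2) =
     kernel_integral (?F (\<Omega> \<times> \<Omega>)) + 2 * kernel_integral (?F (\<Omega> \<times> - \<Omega>))"
    by (simp add: mult_2 add.assoc)
  then show ?thesis
    unfolding energy_def using AE
    by (simp add: set_nn_integral_interaction[OF U] potential_eq)
qed

text \<open>Counting also the pairs inside \<open>\<Omega>\<close> twice gives an integral
  restricted in \<open>x\<close> only; the price is \<open>1/2\<close> in place of
  \<open>1/4\<close>.\<close>

lemma energy_le:
  assumes U[measurable]: "U \<in> borel_measurable borel" and [measurable]: "\<Omega> \<in> sets borel"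
    and AE: "AE z in lborel. K z = k z" "AE x in lborel. u x = U x"
  shows "energy K G u \<Omega> \<le> kernel_integral (\<lambda>x y. indicator \<Omega> x * (U x - U y)\<^sup>2) / 2 +
    (\<integral>\<^sup>+x\<in>\<Omega>. ennreal (G (U x)) \<partial>lborel)"
proof -
  let ?F = "\<lambda>A x y. indicator A (x, y) * (U x - U y)\<^sup>2"
  have m: "case_prod (?F A) \<in> borel_measurable (borel \<Otimes>\<^sub>M borel)"
    if [measurable]: "A \<in> sets (borel \<Otimes>\<^sub>M borel)" for A by measurable
  have "kernel_integral (?F (\<Omega> \<times> \<Omega>)) + 2 * kernel_integral (?F (\<Omega> \<times> - \<Omega>)) \<le>
    2 * (kernel_integral (?F (\<Omega> \<times> \<Omega>)) + kernel_integral (?F (\<Omega> \<times> - \<Omega>)))"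
    by (simp add: distrib_left mult_2 add.assoc)
  also have "kernel_integral (?F (\<Omega> \<times> \<Omega>)) + kernel_integral (?F (\<Omega> \<times> - \<Omega>)) =
     kernel_integral (\<lambda>x y. ?F (\<Omega> \<times> \<Omega>) x y + ?F (\<Omega> \<times> - \<Omega>) x y)"
    using kernel_integral_add[OF m[of "\<Omega> \<times> \<Omega>"] m[of "\<Omega> \<times> - \<Omega>"]] by simp
  also have "\<dots> = kernel_integral (\<lambda>x y. indicator \<Omega> x * (U x - U y)\<^sup>2)"
    by (intro arg_cong[of _ _ kernel_integral] ext) (auto split: split_indicator)
  finally have *: "kernel_integral (?F (\<Omega> \<times> \<Omega>)) + 2 * kernel_integral (?F (\<Omega> \<times> - \<Omega>)) \<le>
    2 * kernel_integral (\<lambda>x y. indicator \<Omega> x * (U x - U y)\<^sup>2)" .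
  have "(kernel_integral (?F (\<Omega> \<times> \<Omega>)) + 2 * kernel_integral (?F (\<Omega> \<times> - \<Omega>))) / 4 \<le>
     2 * kernel_integral (\<lambda>x y. indicator \<Omega> x * (U x - U y)\<^sup>2) / 4"
    by (intro divide_right_mono_ennreal *)
  also note ennreal_two_times_divide_4
  finally show ?thesis
    unfolding energy_def using AE
    by (simp add: set_nn_integral_interaction[OF U] potential_eq add_right_mono)
qed

end

section \<open>Comparison of a minimizer with competitors\<close>

definition ae_doubly_radial_odd :: "('m::finite pt \<Rightarrow> real) \<Rightarrow> bool" where
  "ae_doubly_radial_odd w \<longleftrightarrow>
     (\<exists>v. doubly_radial v \<and> simons_odd v \<and> (AE x in lborel. w x = v x))"

text \<open>All competitors arise from \<open>U\<close> by a pointwise operation depending on the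
  two norms. The symmetry class is preserved when exchanging the norms and changing the sign of the
  value changes the sign of the result.\<close>

lemma ae_doubly_radial_odd_compose:
  assumes "ae_doubly_radial_odd U"
    and odd: "\<And>a b t. \<Phi> b a (- t) = - \<Phi> a b t"
    and w: "\<And>x. w x = \<Phi> (norm (fst x)) (norm (snd x)) (U x)"
  shows "ae_doubly_radial_odd w"
proof -
  obtain v f where v: "\<And>x. v x = f (norm (fst x)) (norm (snd x))" "simons_odd v"
    "AE x in lborel. U x = v x"
    using assms(1) unfolding ae_doubly_radial_odd_def doubly_radial_def by blast
  let ?v = "\<lambda>x. \<Phi> (norm (fst x)) (norm (snd x)) (v x)"
  have "doubly_radial ?v"
    unfolding doubly_radial_def
    by (rule exI[of _ "\<lambda>a b. \<Phi> a b (f a b)"]) (simp add: v(1))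
  moreover have "simons_odd ?v"
    unfolding simons_odd_def
  proof
    fix x
    have "v (prod.swap x) = - v x" using v(2) unfolding simons_odd_def by (metis minus_minus)
    then show "?v x = - ?v (prod.swap x)"
      using odd[of "norm (snd x)" "norm (fst x)" "v x"] by simp
  qed
  moreover have "AE x in lborel. w x = ?v x"
    using v(3) by eventually_elim (simp add: w)
  ultimately show ?thesis unfolding ae_doubly_radial_odd_def by blast
qed

lemma norm_pair_eq: "norm x = sqrt ((norm (fst x))\<^sup>2 + (norm (snd x))\<^sup>2)"
  by (cases x) (simp add: norm_Pair)

text \<open>Minimality is assumed of \<open>u\<close>, while \<open>U\<close> is any Borel
  representative that vanishes at every point outside the ball. This allows \<open>U\<close> to be
  replaced by its truncation while \<open>u\<close> stays fixed.\<close>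

locale odd_minimizer = symmetric_kernel k
  for k :: "'m::finite pt \<Rightarrow> real" +
  fixes K :: "'m pt \<Rightarrow> real" and G :: "real \<Rightarrow> real" and R :: real
    and u U :: "'m pt \<Rightarrow> real"
  assumes continuous_G: "continuous_on UNIV G"
    and G_nonneg [simp]: "0 \<le> G t"
    and minimizer: "doubly_radial_odd_minimizer K G R u"
    and K_AE: "AE z in lborel. K z = k z"
    and measurable_U [measurable]: "U \<in> borel_measurable borel"
    and u_AE: "AE x in lborel. u x = U x"
    and U_outside: "x \<notin> ball 0 R \<Longrightarrow> U x = 0"
begin

lemma measurable_G [measurable]: "G \<in> borel_measurable borel"
  using continuous_G borel_measurable_continuous_onI by blast

lemma u_in_H0: "u \<in> H0_odd K R"
  using minimizer by (simp add: doubly_radial_odd_minimizer_def)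

lemma ae_doubly_radial_odd_U: "ae_doubly_radial_odd U"
proof -
  obtain v where v: "doubly_radial v" "simons_odd v" "AE x in lebesgue. u x = v x"
    using u_in_H0 unfolding H0_odd_def by blast
  have "AE x in lborel. U x = v x"
    using v(3) u_AE unfolding AE_completion_iff by eventually_elim simp
  then show ?thesis using v unfolding ae_doubly_radial_odd_def by blast
qed

lemma complement_square_measurable:
  "- ((- ball 0 R) \<times> (- ball 0 R)) \<in> sets (borel \<Otimes>\<^sub>M (borel :: 'm pt measure))"
    (is "- ?A \<in> _")
proof -
  have "?A \<in> sets (borel \<Otimes>\<^sub>M (borel :: 'm pt measure))" by (intro pair_measureI) auto
  from sets.compl_sets[OF this] show ?thesis
    by (simp add: space_pair_measure Compl_eq_Diff_UNIV)
qed

lemma complement_square_interaction: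
  fixes w :: "'m pt \<Rightarrow> real"
  assumes out: "\<And>x. x \<notin> ball 0 R \<Longrightarrow> w x = 0"
  shows "kernel_integral (\<lambda>x y. indicator (- ((- ball 0 R) \<times> (- ball 0 R))) (x, y) * (w x - w y)\<^sup>2) =
    kernel_integral (\<lambda>x y. (w x - w y)\<^sup>2)"
  using out by (intro arg_cong[of _ _ kernel_integral] ext) (auto split: split_indicator)

lemma H0_oddI:
  assumes w [measurable]: "w \<in> borel_measurable borel" and bd: "\<And>x. \<bar>w x\<bar> \<le> 1"
    and out: "\<And>x. x \<notin> ball 0 R \<Longrightarrow> w x = 0" and odd: "ae_doubly_radial_odd w"
    and fin: "kernel_integral (\<lambda>x y. (w x - w y)\<^sup>2) < \<infinity>"
  shows "w \<in> H0_odd K R"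
  unfolding H0_odd_def
proof (intro CollectI conjI)
  have wl: "w \<in> borel_measurable lebesgue" by (simp add: measurable_completion)
  show wm: "w \<in> borel_measurable (lebesgue_on (ball 0 R))"
    using wl by (rule measurable_restrict_space1)
  interpret finite_measure "lebesgue_on (ball (0::'m pt) R)"
    by (rule finite_measure_lebesgue_on) simp
  show "integrable (lebesgue_on (ball 0 R)) (\<lambda>x. (w x)\<^sup>2)"
    using bd wm by (intro integrable_const_bound[of _ 1]) (auto simp: abs_square_le_1)
  show "AE x in lebesgue. x \<notin> ball 0 R \<longrightarrow> w x = 0" using out by auto
  have "(\<integral>\<^sup>+ x. \<integral>\<^sup>+ y. interaction K w x y * indicator (- ((- ball 0 R) \<times> (- ball 0 R))) (x, y)
        \<partial>lebesgue \<partial>lebesgue) = kernel_integral (\<lambda>x y. (w x - w y)\<^sup>2)"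
    using nn_integral_interaction[OF w complement_square_measurable K_AE, of w]
      complement_square_interaction[OF out] by simp
  then show "(\<integral>\<^sup>+ x. \<integral>\<^sup>+ y. interaction K w x y * indicator (- ((- ball 0 R) \<times> (- ball 0 R))) (x, y)
        \<partial>lebesgue \<partial>lebesgue) < \<infinity>" using fin by simp
  show "\<exists>v. doubly_radial v \<and> simons_odd v \<and> (AE x in lebesgue. w x = v x)"
    using odd unfolding ae_doubly_radial_odd_def AE_completion_iff .
qed

lemma kernel_integral_U_finite: "kernel_integral (\<lambda>x y. (U x - U y)\<^sup>2) < \<infinity>"
proof -
  have "(\<integral>\<^sup>+ x. \<integral>\<^sup>+ y. interaction K u x y * indicator (- ((- ball 0 R) \<times> (- ball 0 R))) (x, y)
        \<partial>lebesgue \<partial>lebesgue) = kernel_integral (\<lambda>x y. (U x - U y)\<^sup>2)"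
    using nn_integral_interaction[OF measurable_U complement_square_measurable K_AE u_AE]
      complement_square_interaction[of U] U_outside by simp
  then show ?thesis using u_in_H0 unfolding H0_odd_def by simp
qed

lemma energy_u_eq:
  "energy K G u (ball 0 R) = kernel_integral (\<lambda>x y. (U x - U y)\<^sup>2) / 4 +
    (\<integral>\<^sup>+x\<in>ball 0 R. ennreal (G (U x)) \<partial>lborel)"
  by (rule energy_eq[OF measurable_U _ K_AE u_AE U_outside]) auto

text \<open>Comparison with the zero function. Finiteness is what permits cancelling this energy in
  \<open>comparison\<close>.\<close>

lemma energy_u_finite: "energy K G u (ball 0 R) < \<infinity>"
proof -
  have "ae_doubly_radial_odd (\<lambda>x::'m pt. 0)"
    unfolding ae_doubly_radial_odd_def doubly_radial_def simons_odd_def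
    by (intro exI[of _ "\<lambda>_. 0"]) auto
  then have "(\<lambda>x. 0) \<in> H0_odd K R"
    by (intro H0_oddI) (auto simp: kernel_integral_def)
  then have "energy K G u (ball 0 R) \<le> energy K G (\<lambda>x. 0) (ball 0 R)"
    using minimizer unfolding doubly_radial_odd_minimizer_def by blast
  also have "\<dots> = (\<integral>\<^sup>+x\<in>ball (0::'m pt) R. ennreal (G 0) \<partial>lborel)"
    by (subst energy_eq[where U="\<lambda>x. 0", OF _ _ K_AE]) (auto simp: kernel_integral_def)
  also have "\<dots> = ennreal (G 0) * emeasure lborel (ball (0::'m pt) R)"
    by (rule nn_integral_cmult_indicator) simp
  also have "\<dots> < \<infinity>" using emeasure_lborel_ball_finite by (auto simp: ennreal_mult_less_top)
  finally show ?thesis .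
qed

text \<open>\<open>w\<close> belongs to the admissible class because its interaction energy is finite as soon as the
  right-hand side is.\<close>

lemma comparison:
  assumes w [measurable]: "w \<in> borel_measurable borel" and bd: "\<And>x. \<bar>w x\<bar> \<le> 1"
    and out: "\<And>x. x \<notin> ball 0 R \<Longrightarrow> w x = 0" and odd: "ae_doubly_radial_odd w"
    and P [measurable]: "case_prod P \<in> borel_measurable (borel \<Otimes>\<^sub>M borel)"
    and N [measurable]: "case_prod N \<in> borel_measurable (borel \<Otimes>\<^sub>M borel)"
    and p [measurable]: "p \<in> borel_measurable borel" and q [measurable]: "q \<in> borel_measurable borel"
    and nn: "\<And>x y. 0 \<le> P x y" "\<And>x y. 0 \<le> N x y" "\<And>x. 0 \<le> p x" "\<And>x. 0 \<le> q x"
    and PN: "\<And>x y. (w x - w y)\<^sup>2 + P x y \<le> (U x - U y)\<^sup>2 + N x y"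
    and pq: "\<And>x. x \<in> ball 0 R \<Longrightarrow> G (w x) + p x \<le> G (U x) + q x"
  shows "kernel_integral P / 4 + (\<integral>\<^sup>+x\<in>ball 0 R. ennreal (p x) \<partial>lborel) \<le>
    kernel_integral N / 4 + (\<integral>\<^sup>+x\<in>ball 0 R. ennreal (q x) \<partial>lborel)" (is "?l \<le> ?r")
proof (cases "?r = \<infinity>")
  case False
  let ?B = "ball (0::'m pt) R"
  have [measurable]: "?B \<in> sets borel" by simp
  have Nfin: "kernel_integral N < \<infinity>"
    using False by (cases "kernel_integral N = top") (auto simp: less_top ennreal_top_divide)
  have "kernel_integral (\<lambda>x y. (w x - w y)\<^sup>2 + P x y) = kernel_integral (\<lambda>x y. (w x - w y)\<^sup>2) + kernel_integral P"
    using nn by (intro kernel_integral_add) auto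
  moreover have "kernel_integral (\<lambda>x y. (U x - U y)\<^sup>2 + N x y) = kernel_integral (\<lambda>x y. (U x - U y)\<^sup>2) + kernel_integral N"
    using nn by (intro kernel_integral_add) auto
  \<comment> \<open>Gains \<open>P\<close> and losses \<open>N\<close> are added on opposite sides,
    which avoids subtracting possibly infinite integrals.\<close>
  ultimately have kin: "kernel_integral (\<lambda>x y. (w x - w y)\<^sup>2) + kernel_integral P \<le>
      kernel_integral (\<lambda>x y. (U x - U y)\<^sup>2) + kernel_integral N"
    using kernel_integral_mono[of "\<lambda>x y. (w x - w y)\<^sup>2 + P x y" "\<lambda>x y. (U x - U y)\<^sup>2 + N x y", OF PN]
    by simp
  have "kernel_integral (\<lambda>x y. (w x - w y)\<^sup>2) \<le> kernel_integral (\<lambda>x y. (w x - w y)\<^sup>2) + kernel_integral P" by simp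
  also note kin
  also have "kernel_integral (\<lambda>x y. (U x - U y)\<^sup>2) + kernel_integral N < \<infinity>"
    using Nfin kernel_integral_U_finite by (simp add: ennreal_add_eq_top less_top)
  finally have "w \<in> H0_odd K R" using H0_oddI[OF w bd out odd] by blast
  then have min: "energy K G u ?B \<le> energy K G w ?B"
    using minimizer unfolding doubly_radial_odd_minimizer_def by blast
  have ew: "energy K G w ?B = kernel_integral (\<lambda>x y. (w x - w y)\<^sup>2) / 4 + (\<integral>\<^sup>+x\<in>?B. ennreal (G (w x)) \<partial>lborel)"
    by (rule energy_eq[OF w _ K_AE _ out]) auto
  have add: "(\<integral>\<^sup>+x\<in>?B. ennreal (f x) \<partial>lborel) + (\<integral>\<^sup>+x\<in>?B. ennreal (g x) \<partial>lborel) =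
      (\<integral>\<^sup>+x\<in>?B. ennreal (f x + g x) \<partial>lborel)"
    if [measurable]: "f \<in> borel_measurable borel" "g \<in> borel_measurable borel"
      and "\<And>x. 0 \<le> f x" "\<And>x. 0 \<le> g x" for f g
  proof -
    have "(\<integral>\<^sup>+x\<in>?B. ennreal (f x + g x) \<partial>lborel) =
       (\<integral>\<^sup>+x. ennreal (f x) * indicator ?B x + ennreal (g x) * indicator ?B x \<partial>lborel)"
      using that by (intro nn_integral_cong) (simp add: distrib_right)
    also have "\<dots> = (\<integral>\<^sup>+x\<in>?B. ennreal (f x) \<partial>lborel) + (\<integral>\<^sup>+x\<in>?B. ennreal (g x) \<partial>lborel)"
      by (intro nn_integral_add) measurable
    finally show ?thesis by simp
  qed
  have pot: "(\<integral>\<^sup>+x\<in>?B. ennreal (G (w x)) \<partial>lborel) + (\<integral>\<^sup>+x\<in>?B. ennreal (p x) \<partial>lborel) \<le>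
     (\<integral>\<^sup>+x\<in>?B. ennreal (G (U x)) \<partial>lborel) + (\<integral>\<^sup>+x\<in>?B. ennreal (q x) \<partial>lborel)"
  proof -
    have "(\<integral>\<^sup>+x\<in>?B. ennreal (G (w x) + p x) \<partial>lborel) \<le> (\<integral>\<^sup>+x\<in>?B. ennreal (G (U x) + q x) \<partial>lborel)"
      using ennreal_leI[OF pq] by (intro nn_integral_mono) (simp split: split_indicator)
    then show ?thesis using nn by (simp add: add)
  qed
  have "energy K G w ?B + ?l =
    (kernel_integral (\<lambda>x y. (w x - w y)\<^sup>2) + kernel_integral P) / 4 +
    ((\<integral>\<^sup>+x\<in>?B. ennreal (G (w x)) \<partial>lborel) + (\<integral>\<^sup>+x\<in>?B. ennreal (p x) \<partial>lborel))"
    unfolding ew by (simp add: add_divide_distrib_ennreal ac_simps)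
  also have "\<dots> \<le> (kernel_integral (\<lambda>x y. (U x - U y)\<^sup>2) + kernel_integral N) / 4 +
    ((\<integral>\<^sup>+x\<in>?B. ennreal (G (U x)) \<partial>lborel) + (\<integral>\<^sup>+x\<in>?B. ennreal (q x) \<partial>lborel))"
    by (intro add_mono pot divide_right_mono_ennreal kin)
  also have "\<dots> = energy K G u ?B + ?r"
    unfolding energy_u_eq by (simp add: add_divide_distrib_ennreal ac_simps)
  \<comment> \<open>Minimality replaces the energy of \<open>w\<close> by that of \<open>u\<close>,
    which is finite and cancels.\<close>
  finally have "energy K G u ?B + ?l \<le> energy K G u ?B + ?r"
    using min by (meson add_right_mono order_trans)
  then show ?thesis
    using energy_u_finite by (auto simp: ennreal_add_left_cancel_le)
qed auto

end

lemma ae_doubly_radial_odd_truncation: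
  assumes "ae_doubly_radial_odd U"
  shows "ae_doubly_radial_odd (\<lambda>x. max (-1) (min 1 (U x)))"
  using assms by (rule ae_doubly_radial_odd_compose[where \<Phi>="\<lambda>_ _ t. max (-1) (min 1 t)"]) auto

text \<open>Truncating at \<open>\<plusminus>1\<close> decreases the potential energy and strictly decreases the
  interaction of \<open>{\<bar>U\<bar> > 1}\<close> with the complement of the ball, where \<open>U\<close> vanishes.\<close>

lemma (in odd_minimizer) AE_abs_U_le_1:
  assumes pos: "AE z in lborel. 0 < k z" and G1: "G 1 = 0" "G (-1) = 0"
  shows "AE x in lborel. \<bar>U x\<bar> \<le> 1"
proof -
  let ?w = "\<lambda>x. max (-1) (min 1 (U x))"
  let ?P = "\<lambda>x y. (U x - U y)\<^sup>2 - (?w x - ?w y)\<^sup>2"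
  let ?e = "\<lambda>x. max 0 ((U x)\<^sup>2 - 1)"
  have le: "(?w x - ?w y)\<^sup>2 \<le> (U x - U y)\<^sup>2" for x y
    by (intro iffD1[OF abs_le_square_iff]) (auto simp: max_def min_def abs_if)
  have "kernel_integral ?P / 4 + (\<integral>\<^sup>+x\<in>ball (0::'m pt) R. ennreal 0 \<partial>lborel) \<le>
      kernel_integral (\<lambda>x y. 0) / 4 + (\<integral>\<^sup>+x\<in>ball (0::'m pt) R. ennreal 0 \<partial>lborel)"
  proof (rule comparison[where w = ?w and P = ?P and N = "\<lambda>_ _. 0" and p = "\<lambda>_. 0" and q = "\<lambda>_. 0"])
    show "ae_doubly_radial_odd ?w" by (rule ae_doubly_radial_odd_truncation[OF ae_doubly_radial_odd_U])
    show "x \<notin> ball 0 R \<Longrightarrow> ?w x = 0" for x using U_outside by simp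
    show "G (?w x) + 0 \<le> G (U x) + 0" for x using G1 by (auto simp: max_def min_def)
    show "0 \<le> ?P x y" for x y using le[of x y] by simp
  qed auto
  then have "kernel_integral ?P = 0"
    by (simp add: kernel_integral_def ennreal_divide_eq_0_iff)
  \<comment> \<open>For \<open>y\<close> outside the ball \<open>U y = 0\<close>, so where
    \<open>\<bar>U x\<bar> > 1\<close> truncation lowers the squared increment by exactly
    \<open>?e x\<close>.\<close>
  moreover have "kernel_integral (\<lambda>x y. ?e x * indicator (- ball 0 R) y) \<le> kernel_integral ?P"
  proof (rule kernel_integral_mono)
    fix x y
    show "?e x * indicator (- ball 0 R) y \<le> ?P x y"
    proof (cases "y \<in> ball 0 R")
      case True then show ?thesis using le by simp
    next
      case False
      have "(?w x)\<^sup>2 \<le> 1" by (auto simp: abs_square_le_1)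
      then show ?thesis using False U_outside[of y] le[of x y] by (auto simp: max_def)
    qed
  qed
  ultimately have "kernel_integral (\<lambda>x y. ?e x * indicator (- ball 0 R) y) = 0" by simp
  then have "AE x in lborel. (\<integral>\<^sup>+y. ennreal (?e x * indicator (- ball 0 R) y * k (x - y)) \<partial>lborel) = 0"
    unfolding kernel_integral_def by (subst (asm) nn_integral_0_iff_AE) measurable
  then show ?thesis
  proof eventually_elim
    case (elim x)
    show "\<bar>U x\<bar> \<le> 1"
    proof (rule ccontr)
      assume "\<not> \<bar>U x\<bar> \<le> 1"
      then have "?e x > 0" using abs_square_le_1[of "U x"] by auto
      have "AE y in lborel. ennreal (?e x * indicator (- ball 0 R) y * k (x - y)) = 0"
        using elim by (subst (asm) nn_integral_0_iff_AE) measurable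
      \<comment> \<open>As \<open>k (x - y) > 0\<close> for almost every \<open>y\<close>, a point
        with \<open>\<bar>U x\<bar> > 1\<close> would force the complement of the ball to be null,
        which is absurd since the whole space has infinite measure.\<close>
      then have "AE y in lborel. y \<in> ball (0::'m pt) R"
        using AE_lborel_reflect[OF pos, of x]
      proof eventually_elim
        case (elim y)
        show ?case
        proof (rule ccontr)
          assume "y \<notin> ball 0 R"
          then have "?e x * indicator (- ball 0 R) y * k (x - y) > 0" using elim \<open>?e x > 0\<close> by simp
          then show False using elim by (simp add: ennreal_eq_0_iff)
        qed
      qed
      then have "emeasure lborel (UNIV :: 'm pt set) = emeasure lborel (ball (0::'m pt) R)"
        by (intro emeasure_eq_AE) auto
      then show False using emeasure_lborel_ball_finite[of "0::'m pt" R] by simp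
    qed
  qed
qed

section \<open>Volumes of neighbourhoods of the cone and of spheres\<close>

text \<open>\<open>gap x / sqrt 2\<close> is the signed distance to the Simons cone, positive where
  \<open>\<bar>x'\<bar> > \<bar>x''\<bar>\<close>.\<close>

definition gap :: "'m::finite pt \<Rightarrow> real" where
  "gap x = norm (fst x) - norm (snd x)"

lemma measurable_gap [measurable]: "gap \<in> borel_measurable borel"
proof -
  have "continuous_on UNIV (gap :: 'm::finite pt \<Rightarrow> real)"
    unfolding gap_def by (intro continuous_intros)
  then show ?thesis by (rule borel_measurable_continuous_onI)
qed

lemma gap_lipschitz: "\<bar>gap x - gap y\<bar> \<le> 2 * norm (x - y)"
proof -
  have "norm (fst (x - y)) \<le> norm (x - y)" "norm (snd (x - y)) \<le> norm (x - y)"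
    by (metis norm_fst_le prod.collapse, metis norm_snd_le prod.collapse)
  then show ?thesis
    using norm_triangle_ineq3[of "fst x" "fst y"] norm_triangle_ineq3[of "snd x" "snd y"]
    unfolding gap_def by simp
qed

text \<open>Slicing at fixed \<open>x' = a\<close>: each slice lies in a shell of thickness at most
  \<open>2 * t\<close> in dimension \<open>m\<close>, and \<open>a\<close> ranges over a ball of
  radius \<open>T\<close>.\<close>

lemma emeasure_strip_le:
  assumes "0 \<le> T" "0 \<le> t"
  shows "emeasure lborel {x::'m::finite pt. norm x \<le> T \<and> \<bar>gap x\<bar> \<le> t} \<le>
     ennreal (2 * real CARD('m) * (unit_ball_vol (real CARD('m)))\<^sup>2 * t * T ^ (2 * CARD('m) - 1))"
proof -
  let ?m = "CARD('m)" and ?\<omega> = "unit_ball_vol (real CARD('m))"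
  have m: "?m \<ge> 1" by (simp add: Suc_leI)
  let ?X = "{x::'m pt. norm (fst x) \<le> T \<and> norm (snd x) \<le> T \<and> \<bar>gap x\<bar> \<le> t}"
  have X: "?X \<in> sets borel"
    unfolding gap_def by (intro borel_closed closed_Collect_conj closed_Collect_le continuous_intros)
  have X': "?X \<in> sets (borel \<Otimes>\<^sub>M borel)" using X unfolding borel_prod .
  have "emeasure lborel {x::'m pt. norm x \<le> T \<and> \<bar>gap x\<bar> \<le> t} \<le> emeasure lborel ?X"
  proof (rule emeasure_mono)
    show "{x::'m pt. norm x \<le> T \<and> \<bar>gap x\<bar> \<le> t} \<subseteq> ?X"
      using order_trans[OF norm_fst_le] order_trans[OF norm_snd_le] by fastforce
  qed (use X in simp)
  also have "\<dots> = emeasure (lborel \<Otimes>\<^sub>M lborel) ?X" by (simp add: lborel_prod)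
  also have "\<dots> = (\<integral>\<^sup>+a. emeasure lborel (Pair a -` ?X) \<partial>lborel)"
    by (rule lborel.emeasure_pair_measure_alt) (use X' in simp)
  also have "\<dots> \<le> (\<integral>\<^sup>+a. ennreal (2 * real ?m * ?\<omega> * t * T ^ (?m - 1)) * indicator (cball (0::real^'m) T) a \<partial>lborel)"
  proof (rule nn_integral_mono)
    fix a :: "real ^ 'm"
    show "emeasure lborel (Pair a -` ?X) \<le>
      ennreal (2 * real ?m * ?\<omega> * t * T ^ (?m - 1)) * indicator (cball 0 T) a"
    proof (cases "norm a \<le> T")
      case False
      then have e: "Pair a -` ?X = {}" by auto
      show ?thesis unfolding e by simp
    next
      case True
      \<comment> \<open>Capping the outer radius at \<open>T\<close> keeps the surface factor below
        \<open>T ^ (m - 1)\<close> even when \<open>t\<close> is large.\<close>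
      let ?T = "min (norm a + t) T"
      have "emeasure lborel (Pair a -` ?X) \<le> emeasure lborel {b::real^'m. norm a - t \<le> norm b \<and> norm b \<le> ?T}"
        by (rule emeasure_mono) (auto simp: gap_def)
      also have "\<dots> \<le> ennreal (real ?m * ?\<omega> * max 0 (?T - (norm a - t)) * ?T ^ (?m - 1))"
        using emeasure_shell_le[of ?T "norm a - t", where 'a="real^'m"] assms by simp
      also have "\<dots> \<le> ennreal (real ?m * ?\<omega> * (2 * t) * T ^ (?m - 1))"
        using assms by (intro ennreal_leI mult_mono power_mono) auto
      finally show ?thesis using True by (simp add: mult_ac)
    qed
  qed
  also have "\<dots> = ennreal (2 * real ?m * ?\<omega> * t * T ^ (?m - 1)) * ennreal (?\<omega> * T ^ ?m)"
    using assms by (simp add: nn_integral_cmult_indicator emeasure_cball)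
  also have "\<dots> = ennreal (2 * real ?m * ?\<omega>\<^sup>2 * t * T ^ (2 * ?m - 1))"
  proof -
    have "2 * ?m - 1 = (?m - 1) + ?m" using m by simp
    then have "T ^ (2 * ?m - 1) = T ^ (?m - 1) * T ^ ?m" by (simp only: power_add)
    then have "2 * real ?m * ?\<omega> * t * T ^ (?m - 1) * (?\<omega> * T ^ ?m) = 2 * real ?m * ?\<omega>\<^sup>2 * t * T ^ (2 * ?m - 1)"
      by (simp only: power2_eq_square mult_ac)
    then show ?thesis using assms by (subst ennreal_mult'[symmetric]) auto
  qed
  finally show ?thesis .
qed

text \<open>Contains every \<open>x\<close> for which a function that is \<open>\<plusminus>1\<close> away from the cone and from the
  sphere of radius \<open>S + 1\<close> can change between \<open>x\<close> and \<open>x - z\<close>.\<close>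

definition transition_set :: "real \<Rightarrow> 'm::finite pt \<Rightarrow> 'm pt set" where
  "transition_set S z =
     {x. norm x < S + 4 \<and> (\<bar>gap x\<bar> \<le> 2 + 2 * norm z \<or> S + 1 - norm z \<le> norm x)}"

lemma transition_set_sets [measurable]: "transition_set S z \<in> sets borel"
  unfolding transition_set_def by measurable

text \<open>For short displacements the set lies in a strip around the cone together with a shell,
  of volume at most a multiple of \<open>S ^ (2m - 1) * (1 + norm z)\<close>. For long ones the
  volume of the ball of radius \<open>S + 4\<close> is the better bound.\<close>

lemma emeasure_transition_set_le:
  "\<exists>C>0. \<forall>S\<ge>2. \<forall>z::'m::finite pt. emeasure lborel (transition_set S z) \<le>
     ennreal (C * S ^ (2 * CARD('m) - 1) * min (1 + norm z) S)"
proof -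
  let ?m = "CARD('m)" and ?\<omega> = "unit_ball_vol (real CARD('m))"
  let ?n = "2 * ?m" let ?v = "unit_ball_vol (real ?n)"
  have n: "?n = Suc (?n - 1)" by (simp add: Suc_leI)
  have dim: "DIM('m pt) = ?n" by simp
  \<comment> \<open>The powers of 3 come from \<open>S + 4 \<le> 3 * S\<close>. The summands account
    for the strip of half-width \<open>2 + 2 * norm z\<close>, the shell of thickness at most
    \<open>3 + norm z\<close>, and the whole ball.\<close>
  define C where "C = (4 * real ?m * ?\<omega>\<^sup>2 + 3 * real ?n * ?v) * 3 ^ (?n - 1) + ?v * 3 ^ ?n"
  have C: "C > 0" unfolding C_def by (intro add_nonneg_pos) auto
  show ?thesis
  proof (intro exI[of _ C] conjI C allI impI)
    fix S :: real and z :: "'m pt" assume S: "S \<ge> 2"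
    let ?T = "S + 4"
    have T: "?T \<le> 3 * S" using S by simp
    have 1: "emeasure lborel (transition_set S z) \<le> ennreal (C * S ^ (?n - 1) * (1 + norm z))"
    proof -
      let ?A = "{x::'m pt. norm x \<le> ?T \<and> \<bar>gap x\<bar> \<le> 2 + 2 * norm z}"
      let ?B = "{x::'m pt. S + 1 - norm z \<le> norm x \<and> norm x \<le> ?T}"
      have [measurable]: "?A \<in> sets borel" "?B \<in> sets borel" by measurable
      have "emeasure lborel (transition_set S z) \<le> emeasure lborel (?A \<union> ?B)"
        by (rule emeasure_mono) (auto simp: transition_set_def)
      also have "\<dots> \<le> emeasure lborel ?A + emeasure lborel ?B"
        by (rule emeasure_subadditive) auto
      also have "\<dots> \<le> ennreal (2 * real ?m * ?\<omega>\<^sup>2 * (2 + 2 * norm z) * ?T ^ (?n - 1)) +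
          ennreal (real ?n * ?v * (3 + norm z) * ?T ^ (?n - 1))"
        using emeasure_strip_le[of ?T "2 + 2 * norm z", where 'm='m] S
          emeasure_shell_le[of ?T "S + 1 - norm z", where 'a="'m pt", unfolded dim]
        by (intro add_mono) (auto simp: max_def)
      also have "\<dots> = ennreal ((2 * real ?m * ?\<omega>\<^sup>2 * (2 + 2 * norm z) + real ?n * ?v * (3 + norm z)) * ?T ^ (?n - 1))"
        using S by (subst ennreal_plus[symmetric]) (auto simp: distrib_right)
      also have "\<dots> \<le> ennreal ((C / 3 ^ (?n - 1) * (1 + norm z)) * (3 * S) ^ (?n - 1))"
      proof (intro ennreal_leI mult_mono power_mono T)
        have "2 * real ?m * ?\<omega>\<^sup>2 * (2 + 2 * norm z) = 4 * real ?m * ?\<omega>\<^sup>2 * (1 + norm z)" by (simp add: algebra_simps)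
        moreover have "real ?n * ?v * (3 + norm z) \<le> real ?n * ?v * (3 * (1 + norm z))"
          by (intro mult_left_mono) auto
        ultimately have "2 * real ?m * ?\<omega>\<^sup>2 * (2 + 2 * norm z) + real ?n * ?v * (3 + norm z) \<le>
           (4 * real ?m * ?\<omega>\<^sup>2 + 3 * real ?n * ?v) * (1 + norm z)"
          unfolding distrib_right[of _ _ "1 + norm z"] by linarith
        also have "\<dots> \<le> C / 3 ^ (?n - 1) * (1 + norm z)"
        proof (intro mult_right_mono)
          have "(4 * real ?m * ?\<omega>\<^sup>2 + 3 * real ?n * ?v) * 3 ^ (?n - 1) \<le> C" unfolding C_def by simp
          then show "4 * real ?m * ?\<omega>\<^sup>2 + 3 * real ?n * ?v \<le> C / 3 ^ (?n - 1)"
            by (subst pos_le_divide_eq) auto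
        qed auto
        finally show "2 * real ?m * ?\<omega>\<^sup>2 * (2 + 2 * norm z) + real ?n * ?v * (3 + norm z) \<le> C / 3 ^ (?n - 1) * (1 + norm z)" .
      qed (use S C in auto)
      also have "(C / 3 ^ (?n - 1) * (1 + norm z)) * (3 * S) ^ (?n - 1) = C * S ^ (?n - 1) * (1 + norm z)"
        by (simp add: power_mult_distrib)
      finally show ?thesis .
    qed
    have 2: "emeasure lborel (transition_set S z) \<le> ennreal (C * S ^ (?n - 1) * S)"
    proof -
      have "emeasure lborel (transition_set S z) \<le> emeasure lborel (cball (0::'m pt) ?T)"
        by (rule emeasure_mono) (auto simp: transition_set_def)
      also have "\<dots> = ennreal (?v * ?T ^ ?n)" using emeasure_cball[of ?T "0::'m pt"] S unfolding dim by simp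
      also have "\<dots> \<le> ennreal (?v * (3 * S) ^ ?n)"
        using S T by (intro ennreal_leI mult_left_mono power_mono) auto
      also have "\<dots> \<le> ennreal (C * (S ^ (?n - 1) * S))"
      proof (rule ennreal_leI)
        have "?v * (3 * S) ^ ?n = (?v * 3 ^ ?n) * S ^ ?n" by (simp add: power_mult_distrib)
        also have "\<dots> \<le> C * S ^ ?n"
          using S unfolding C_def by (intro mult_right_mono) auto
        also have "S ^ ?n = S ^ (?n - 1) * S" using power_minus_mult[of ?n S] by simp
        finally show "?v * (3 * S) ^ ?n \<le> C * (S ^ (?n - 1) * S)" .
      qed
      finally show ?thesis by (simp add: mult.assoc)
    qed
    show "emeasure lborel (transition_set S z) \<le> ennreal (C * S ^ (?n - 1) * min (1 + norm z) S)"
      using 1 2 by (simp add: min_def)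
  qed
qed

section \<open>The weight that controls all long range and Lipschitz contributions\<close>

text \<open>Dominates, up to a constant, the squared increment of a bounded Lipschitz function that
  can change only on transition pairs. Membership is tested at \<open>x\<close> alone, so later
  bounds use the weight in both orders of the points.\<close>

definition transition_weight :: "real \<Rightarrow> 'm::finite pt \<Rightarrow> 'm pt \<Rightarrow> real" where
  "transition_weight S x y = min ((norm (x - y))\<^sup>2) 1 * indicator (transition_set S (x - y)) x"

lemma measurable_transition_weight [measurable]:
  "case_prod (transition_weight S) \<in> borel_measurable (borel \<Otimes>\<^sub>M borel)"
  unfolding transition_weight_def transition_set_def indicator_def by measurable

lemma transition_weight_nonneg: "0 \<le> transition_weight S x y"
  by (simp add: transition_weight_def)

text \<open>The volume of the sections turns the weight into \<open>truncated_weight\<close>, whose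
  integral against the power kernel is known. The kernel is quantified inside the statement, outside
  the locale, so that \<open>C\<close> is chosen before it.\<close>

lemma kernel_integral_transition_weight_le:
  assumes "0 < \<gamma>" "\<gamma> < 1"
  shows "\<exists>C>0. \<forall>S\<ge>2. \<forall>(k :: 'm::finite pt \<Rightarrow> real) \<Lambda>.
    symmetric_kernel k \<longrightarrow> 0 \<le> \<Lambda> \<longrightarrow>
    (\<forall>z. k z \<le> \<Lambda> * norm z powr (- real DIM('m pt) - 2 * \<gamma>)) \<longrightarrow>
    symmetric_kernel.kernel_integral k (transition_weight S) \<le>
      ennreal (C * \<Lambda> * S ^ (2 * CARD('m) - 1) * energy_rate \<gamma> S)"
proof -
  obtain C1 where C1: "C1 > 0" "\<And>S. S \<ge> 2 \<Longrightarrow> (\<integral>\<^sup>+z. ennreal (truncated_weight S (norm (z::'m pt))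
            * norm z powr (- real DIM('m pt) - 2*\<gamma>)) \<partial>lborel) \<le> ennreal (C1 * energy_rate \<gamma> S)"
    using nn_integral_weight[OF assms, where 'a="'m pt"] by blast
  obtain C2 where C2: "C2 > 0" "\<And>S z. S \<ge> 2 \<Longrightarrow> emeasure lborel (transition_set S (z::'m pt)) \<le>
     ennreal (C2 * S ^ (2 * CARD('m) - 1) * min (1 + norm z) S)"
    using emeasure_transition_set_le[where 'm='m] by blast
  show ?thesis
  proof (intro exI[of _ "C1 * C2"] conjI allI impI)
    show "C1 * C2 > 0" using C1 C2 by simp
    fix S :: real and k :: "'m pt \<Rightarrow> real" and \<Lambda> :: real
    assume S: "S \<ge> 2" and "symmetric_kernel k" and L: "0 \<le> \<Lambda>"
      and k: "\<forall>z. k z \<le> \<Lambda> * norm z powr (- real DIM('m pt) - 2 * \<gamma>)"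
    interpret symmetric_kernel k by fact
    define s where "s = S ^ (2 * CARD('m) - 1)"
    have s: "s \<ge> 0" using S by (simp add: s_def)
    let ?h = "\<lambda>z::'m pt. min ((norm z)\<^sup>2) 1"
    let ?W = "\<lambda>z::'m pt. truncated_weight S (norm z) * norm z powr (- real DIM('m pt) - 2*\<gamma>)"
    have [measurable]: "?W \<in> borel_measurable borel" unfolding truncated_weight_def by measurable
    have "kernel_integral (transition_weight S) \<le> (\<integral>\<^sup>+z. ennreal (?h z * k z) * ennreal (C2 * s * min (1 + norm z) S) \<partial>lborel)"
    proof (rule kernel_integral_le_sections[OF measurable_transition_weight, where h = ?h])
      show "emeasure lborel (transition_set S z) \<le> ennreal (C2 * s * min (1 + norm z) S)" for z :: "'m pt"
        using C2(2)[OF S] unfolding s_def .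
      show "transition_weight S x (x - z) \<le> ?h z * indicator (transition_set S z) x" for x z
        by (simp add: transition_weight_def)
    qed auto
    also have "\<dots> \<le> (\<integral>\<^sup>+z. ennreal (C2 * \<Lambda> * s) * ennreal (?W z) \<partial>lborel)"
    proof (rule nn_integral_mono)
      fix z :: "'m pt"
      have "?h z * k z \<le> ?h z * (\<Lambda> * norm z powr (- real DIM('m pt) - 2 * \<gamma>))"
        by (intro mult_left_mono k[rule_format]) auto
      then have "(?h z * k z) * (C2 * s * min (1 + norm z) S) \<le>
         (?h z * (\<Lambda> * norm z powr (- real DIM('m pt) - 2 * \<gamma>))) * (C2 * s * min (1 + norm z) S)"
        using C2 s S by (intro mult_right_mono) auto
      also have "\<dots> = (C2 * \<Lambda> * s) * ?W z" by (simp only: truncated_weight_def mult_ac)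
      finally show "ennreal (?h z * k z) * ennreal (C2 * s * min (1 + norm z) S) \<le>
          ennreal (C2 * \<Lambda> * s) * ennreal (?W z)"
        using L C2 s by (subst (1 2) ennreal_mult'[symmetric]) (auto intro!: ennreal_leI)
    qed
    also have "\<dots> = ennreal (C2 * \<Lambda> * s) * (\<integral>\<^sup>+z. ennreal (?W z) \<partial>lborel)"
      by (rule nn_integral_cmult) measurable
    also have "\<dots> \<le> ennreal (C2 * \<Lambda> * s) * ennreal (C1 * energy_rate \<gamma> S)"
      by (intro mult_left_mono C1 S) auto
    also have "\<dots> = ennreal (C1 * C2 * \<Lambda> * s * energy_rate \<gamma> S)"
      using L C2 s by (subst ennreal_mult'[symmetric]) (auto simp: mult_ac)
    finally show "kernel_integral (transition_weight S) \<le> ennreal (C1 * C2 * \<Lambda> * S ^ (2 * CARD('m) - 1) * energy_rate \<gamma> S)"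
      by (simp add: s_def)
  qed
qed

section \<open>Cutoff functions and pointwise inequalities\<close>

text \<open>Applied to \<open>gap\<close>, it interpolates between the two sides of the cone. The
  flat part on \<open>[-1, 1]\<close> leaves \<open>U\<close> unmodified near the cone and keeps
  points with ramps of opposite sign apart.\<close>

definition ramp :: "real \<Rightarrow> real" where
  "ramp s = (if s \<le> -2 then -1 else if s \<le> -1 then s + 1 else if s \<le> 1 then 0
     else if s \<le> 2 then s - 1 else 1)"

lemma clip_lipschitz:
  fixes a b x y :: real
  shows "\<bar>max a (min b x) - max a (min b y)\<bar> \<le> \<bar>x - y\<bar>"
proof -
  have *: "\<bar>max a (min b x) - max a (min b y)\<bar> \<le> \<bar>x - y\<bar>" if "x \<le> y" for x y :: real
  proof -
    have "min b x \<le> min b y" "min b y - min b x \<le> y - x" using that by (auto simp: min_def)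
    then have "max a (min b x) \<le> max a (min b y)" "max a (min b y) - max a (min b x) \<le> y - x"
      by (auto simp: max_def)
    then show ?thesis by (simp only: abs_minus_commute[of x] abs_minus_commute[of "max a (min b x)"] abs_of_nonneg diff_ge_0_iff_ge that)
  qed
  show ?thesis using *[of x y] *[of y x] by (cases "x \<le> y") (auto simp: abs_minus_commute)
qed

lemma ramp_minus [simp]: "ramp (- s) = - ramp s"
  by (simp add: ramp_def)

lemma ramp_lipschitz: "\<bar>ramp s - ramp t\<bar> \<le> \<bar>s - t\<bar>"
proof -
  have *: "\<bar>ramp s - ramp t\<bar> \<le> \<bar>s - t\<bar>" if "s \<le> t" for s t
    using that by (simp add: ramp_def)
  show ?thesis using *[of s t] *[of t s] by (cases "s \<le> t") (auto simp: abs_minus_commute)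
qed

lemma abs_ramp_le_1: "\<bar>ramp s\<bar> \<le> 1"
  by (simp add: ramp_def)

lemma ramp_eq_sgn: "2 \<le> \<bar>s\<bar> \<Longrightarrow> ramp s = sgn s"
  by (cases "s > 0") (simp_all add: ramp_def)

lemma ramp_eq_sgn_mult: "ramp s = sgn s * \<bar>ramp s\<bar>"
  by (cases s "0::real" rule: linorder_cases) (simp_all add: ramp_def)

lemma measurable_ramp [measurable]: "ramp \<in> borel_measurable borel"
  unfolding ramp_def[abs_def] by measurable

text \<open>Localizes to the strip \<open>\<bar>gap x\<bar> < 2\<close>. The radial factor is 1 up
  to radius \<open>S + 3\<close>, one unit beyond the radius \<open>S + 2\<close>, to leave room for
  pairs at distance less than 1.\<close>

definition cutoff :: "real \<Rightarrow> 'm::finite pt \<Rightarrow> real" where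
  "cutoff S x = (1 - \<bar>ramp (gap x)\<bar>) * max 0 (min 1 (S + 4 - norm x))"

text \<open>Falls from \<open>1\<close> at radius \<open>S + 1\<close> to \<open>-1\<close> at
  radius \<open>S + 2\<close>; hence the slope and the centre \<open>S + 3/2\<close>.\<close>

definition level :: "real \<Rightarrow> real \<Rightarrow> real" where
  "level S r = max (-1) (min 1 (2 * (S + 3/2 - r)))"

text \<open>The part of \<open>\<phi>\<close> that does not involve \<open>U\<close>, hence
  Lipschitz with an explicit constant.\<close>

definition profile :: "real \<Rightarrow> 'm::finite pt \<Rightarrow> real" where
  "profile S x = ramp (gap x) * level S (norm x)"

lemma abs_mult_diff_le:
  fixes a b c d :: real
  assumes "\<bar>a\<bar> \<le> 1" "\<bar>d\<bar> \<le> 1"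
  shows "\<bar>a * b - c * d\<bar> \<le> \<bar>b - d\<bar> + \<bar>a - c\<bar>"
proof -
  have "a * b - c * d = a * (b - d) + (a - c) * d" by (simp add: algebra_simps)
  then have "\<bar>a * b - c * d\<bar> \<le> \<bar>a\<bar> * \<bar>b - d\<bar> + \<bar>a - c\<bar> * \<bar>d\<bar>"
    by (metis abs_mult abs_triangle_ineq)
  also have "\<dots> \<le> 1 * \<bar>b - d\<bar> + \<bar>a - c\<bar> * 1" using assms by (intro add_mono mult_mono) auto
  finally show ?thesis by simp
qed

lemma abs_level_le_1: "\<bar>level S r\<bar> \<le> 1"
  by (auto simp: level_def max_def min_def)

lemma profile_lipschitz: "\<bar>profile S x - profile S y\<bar> \<le> 4 * norm (x - y)"
proof -
  have "\<bar>level S (norm x) - level S (norm y)\<bar> \<le>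
      \<bar>2 * (S + 3/2 - norm x) - 2 * (S + 3/2 - norm y)\<bar>"
    unfolding level_def by (rule clip_lipschitz)
  also have "\<dots> = 2 * \<bar>norm x - norm y\<bar>" by (simp add: abs_if)
  also have "\<dots> \<le> 2 * norm (x - y)" using norm_triangle_ineq3[of x y] by simp
  finally have "\<bar>level S (norm x) - level S (norm y)\<bar> \<le> 2 * norm (x - y)" .
  moreover have "\<bar>ramp (gap x) - ramp (gap y)\<bar> \<le> 2 * norm (x - y)"
    using ramp_lipschitz gap_lipschitz order_trans by blast
  ultimately have "\<bar>profile S x - profile S y\<bar> \<le> 2 * norm (x - y) + 2 * norm (x - y)"
    unfolding profile_def
    by (intro order_trans[OF abs_mult_diff_le[OF abs_ramp_le_1 abs_level_le_1] add_mono])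
  then show ?thesis by simp
qed

lemma cutoff_bounds: "0 \<le> cutoff S x" "cutoff S x \<le> 1"
  unfolding cutoff_def using abs_ramp_le_1[of "gap x"] by (auto intro!: mult_le_one)

lemma cutoff_lipschitz: "\<bar>cutoff S x - cutoff S y\<bar> \<le> 3 * norm (x - y)"
proof -
  let ?c = "\<lambda>r. max 0 (min 1 (S + 4 - r))"
  have "\<bar>?c (norm x) - ?c (norm y)\<bar> \<le> \<bar>(S + 4 - norm x) - (S + 4 - norm y)\<bar>"
    by (rule clip_lipschitz)
  also have "\<dots> = \<bar>norm x - norm y\<bar>" by simp
  also have "\<dots> \<le> norm (x - y)" by (rule norm_triangle_ineq3)
  finally have "\<bar>?c (norm x) - ?c (norm y)\<bar> \<le> norm (x - y)" .
  moreover have "\<bar>(1 - \<bar>ramp (gap x)\<bar>) - (1 - \<bar>ramp (gap y)\<bar>)\<bar> \<le> 2 * norm (x - y)"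
    using ramp_lipschitz[of "gap x" "gap y"] gap_lipschitz[of x y] by linarith
  moreover have "\<bar>1 - \<bar>ramp (gap x)\<bar>\<bar> \<le> 1" using abs_ramp_le_1[of "gap x"] by simp
  moreover have "\<bar>?c (norm y)\<bar> \<le> 1" by simp
  ultimately have "\<bar>cutoff S x - cutoff S y\<bar> \<le> norm (x - y) + 2 * norm (x - y)"
    unfolding cutoff_def by (intro order_trans[OF abs_mult_diff_le add_mono])
  then show ?thesis by simp
qed

lemma cutoff_nonzero_imp: "cutoff S x \<noteq> 0 \<Longrightarrow> \<bar>gap x\<bar> < 2 \<and> norm x < S + 4"
proof -
  assume "cutoff S x \<noteq> 0"
  moreover have "\<bar>ramp (gap x)\<bar> = 1" if "\<not> \<bar>gap x\<bar> < 2"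
    using that ramp_eq_sgn[of "gap x"] by (auto simp: abs_sgn_eq)
  ultimately show ?thesis by (auto simp: cutoff_def)
qed

lemma measurable_cutoff [measurable]: "cutoff S \<in> borel_measurable borel"
  unfolding cutoff_def by measurable

lemma measurable_level [measurable]: "level S \<in> borel_measurable borel"
  unfolding level_def by measurable

section \<open>Pointwise inequalities behind the two comparisons\<close>

text \<open>With \<open>p = s * a\<close> and \<open>q = t * b\<close>, expanding the square
  produces the cross term \<open>(a - b) * (s * p - q * t)\<close>, which equals
  \<open>(p - q)^2 - a * b * (s - t)^2\<close>. The remaining quarter of
  \<open>(s * p - q * t)^2\<close> absorbs only half of \<open>(p - q)^2\<close>.\<close>

lemma caccioppoli_pointwise:
  fixes a b s t :: real
  assumes "\<bar>a\<bar> \<le> 1" "\<bar>b\<bar> \<le> 1" "0 \<le> s" "s \<le> 1" "0 \<le> t" "t \<le> 1"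
  shows "((1 - s\<^sup>2 / 2) * a - (1 - t\<^sup>2 / 2) * b)\<^sup>2 + 1/2 * (s * a - t * b)\<^sup>2 \<le>
    (a - b)\<^sup>2 + 3/2 * (s - t)\<^sup>2"
proof -
  define p q where "p = s * a" and "q = t * b"
  have pq: "\<bar>p\<bar> \<le> 1" "\<bar>q\<bar> \<le> 1"
    using assms by (auto simp: p_def q_def abs_mult intro!: mult_le_one)
  have "\<bar>s * p - q * t\<bar> \<le> \<bar>p - q\<bar> + \<bar>s - t\<bar>"
  proof -
    have "s * p - q * t = s * (p - q) + (s - t) * q" by (simp add: algebra_simps)
    then have "\<bar>s * p - q * t\<bar> \<le> \<bar>s\<bar> * \<bar>p - q\<bar> + \<bar>s - t\<bar> * \<bar>q\<bar>"
      by (metis abs_mult abs_triangle_ineq)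
    also have "\<dots> \<le> 1 * \<bar>p - q\<bar> + \<bar>s - t\<bar> * 1" using assms pq by (intro add_mono mult_mono) auto
    finally show ?thesis by simp
  qed
  then have "(s * p - q * t)\<^sup>2 \<le> (\<bar>p - q\<bar> + \<bar>s - t\<bar>)\<^sup>2"
    using power_mono[of "\<bar>s * p - q * t\<bar>" "\<bar>p - q\<bar> + \<bar>s - t\<bar>" 2] by simp
  also have "\<dots> \<le> 2 * (p - q)\<^sup>2 + 2 * (s - t)\<^sup>2"
    using sum_squares_bound[of "\<bar>p - q\<bar>" "\<bar>s - t\<bar>"] by (simp add: power2_sum)
  finally have 1: "(s * p - q * t)\<^sup>2 \<le> 2 * (p - q)\<^sup>2 + 2 * (s - t)\<^sup>2" .
  have "\<bar>a * b\<bar> \<le> 1" using assms by (auto simp: abs_mult intro!: mult_le_one)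
  then have ab: "a * b \<le> 1" by linarith
  have 2: "a * b * (s - t)\<^sup>2 \<le> (s - t)\<^sup>2"
    using mult_right_mono[OF ab, of "(s - t)\<^sup>2"] by simp
  have "(1 - s\<^sup>2 / 2) * a - (1 - t\<^sup>2 / 2) * b = (a - b) - (s * p - q * t) / 2"
    by (simp add: p_def q_def power2_eq_square field_simps)
  moreover have "((a - b) - (s * p - q * t) / 2)\<^sup>2 =
      (a - b)\<^sup>2 - (a - b) * (s * p - q * t) + 1/4 * (s * p - q * t)\<^sup>2"
    by (simp add: power2_diff power_divide)
  moreover have "(a - b) * (s * p - q * t) = (p - q)\<^sup>2 - a * b * (s - t)\<^sup>2"
    unfolding p_def q_def by algebra
  ultimately have "((1 - s\<^sup>2 / 2) * a - (1 - t\<^sup>2 / 2) * b)\<^sup>2 =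
     (a - b)\<^sup>2 - (p - q)\<^sup>2 + a * b * (s - t)\<^sup>2 + 1/4 * (s * p - q * t)\<^sup>2"
    by simp
  then show ?thesis using 1 2 unfolding p_def q_def by linarith
qed

text \<open>With \<open>h = w - u\<close> and \<open>g = m - u\<close> one has \<open>f = u + h + g\<close>, and the difference of the two
  sides is twice the product of the increments of \<open>h\<close> and \<open>g\<close>. On one side of the cone this
  product has a sign, since \<open>h g = 0\<close>.\<close>

lemma competitor_pointwise:
  fixes u1 u2 :: real
  assumes u: "\<bar>u1\<bar> \<le> 1" "\<bar>u2\<bar> \<le> 1" and r: "\<bar>r1\<bar> \<le> 1" "\<bar>r2\<bar> \<le> 1" and t: "\<bar>t1\<bar> \<le> 1" "\<bar>t2\<bar> \<le> 1"
    and t1: "t1 = s1 * \<bar>t1\<bar>" and t2: "t2 = s2 * \<bar>t2\<bar>" and s: "s1 \<in> {-1,0,1}" "s2 \<in> {-1,0,1}"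
    and w: "w1 = u1 + t1 * max 0 (r1 - s1 * u1)" "w2 = u2 + t2 * max 0 (r2 - s2 * u2)"
    and m: "m1 = u1 - t1 * max 0 (s1 * u1 - r1)" "m2 = u2 - t2 * max 0 (s2 * u2 - r2)"
    and f: "f1 = (1 - \<bar>t1\<bar>) * u1 + t1 * r1" "f2 = (1 - \<bar>t2\<bar>) * u2 + t2 * r2"
    and e: "0 \<le> e1" "0 \<le> e2"
    and e1: "t1 * t2 < 0 \<Longrightarrow> r1 > s1 * u1 \<Longrightarrow> 1 \<le> e1"
    and e2: "t1 * t2 < 0 \<Longrightarrow> r2 > s2 * u2 \<Longrightarrow> 1 \<le> e2"
  shows "(w1 - w2)\<^sup>2 + (m1 - m2)\<^sup>2 \<le> (u1 - u2)\<^sup>2 + ((f1 - f2)\<^sup>2 + 8 * (e1 + e2))"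
proof -
  \<comment> \<open>In the application \<open>t\<close>, \<open>s\<close>, \<open>r\<close> are the
    ramp and sign of the gap and the level. \<open>A\<close> and \<open>B\<close> are the positive
    and negative parts of \<open>r - s * u\<close>, so at each point one of them vanishes.\<close>
  define A1 A2 B1 B2 where "A1 = max 0 (r1 - s1 * u1)" and "A2 = max 0 (r2 - s2 * u2)"
    and "B1 = max 0 (s1 * u1 - r1)" and "B2 = max 0 (s2 * u2 - r2)"
  have su: "\<bar>s1 * u1\<bar> \<le> 1" "\<bar>s2 * u2\<bar> \<le> 1" using s u by auto
  have AB: "0 \<le> A1" "0 \<le> A2" "0 \<le> B1" "0 \<le> B2" "A1 * B1 = 0" "A2 * B2 = 0"
    "A1 \<le> 2" "A2 \<le> 2" "B1 \<le> 2" "B2 \<le> 2"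
  proof -
    have "0 \<le> max 0 (a - b) \<and> max 0 (a - b) \<le> 2 \<and> max 0 (a - b) * max 0 (b - a) = 0"
      if "\<bar>a\<bar> \<le> 1" "\<bar>b\<bar> \<le> 1" for a b :: real
      using that by (cases "a \<le> b") (simp_all add: max_def)
    from this[OF r(1) su(1)] this[OF r(2) su(2)] this[OF su(1) r(1)] this[OF su(2) r(2)]
    show "0 \<le> A1" "0 \<le> A2" "0 \<le> B1" "0 \<le> B2" "A1 * B1 = 0" "A2 * B2 = 0"
      "A1 \<le> 2" "A2 \<le> 2" "B1 \<le> 2" "B2 \<le> 2"
      unfolding A1_def A2_def B1_def B2_def by blast+
  qed
  have tu: "\<bar>t1\<bar> * u1 = t1 * (s1 * u1)" "\<bar>t2\<bar> * u2 = t2 * (s2 * u2)"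
  proof -
    have "\<bar>t\<bar> * u = t * (s * u)" if t: "t = s * \<bar>t\<bar>" and s: "s \<in> {-1,0,1}" for s t u :: real
    proof -
      consider "s = -1" | "s = 0" | "s = 1" using s by blast
      then show ?thesis
      proof cases
        case 1
        have "\<bar>t\<bar> = - t" using t unfolding 1 by linarith
        then show ?thesis unfolding 1 by simp
      next
        case 2
        have "t = 0" using t unfolding 2 by simp
        then show ?thesis by simp
      next
        case 3
        have "\<bar>t\<bar> = t" using t unfolding 3 by linarith
        then show ?thesis unfolding 3 by simp
      qed
    qed
    from this[OF t1 s(1)] this[OF t2 s(2)]
    show "\<bar>t1\<bar> * u1 = t1 * (s1 * u1)" "\<bar>t2\<bar> * u2 = t2 * (s2 * u2)" by blast+
  qed
  have "A1 - B1 = r1 - s1 * u1" "A2 - B2 = r2 - s2 * u2"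
    by (simp_all add: A1_def A2_def B1_def B2_def max_def)
  moreover have "f1 = u1 + t1 * (r1 - s1 * u1)" "f2 = u2 + t2 * (r2 - s2 * u2)"
    unfolding f left_diff_distrib right_diff_distrib tu by simp_all
  ultimately have f': "f1 = u1 + t1 * A1 - t1 * B1" "f2 = u2 + t2 * A2 - t2 * B2"
    by (simp_all only: add_diff_eq[symmetric] right_diff_distrib[symmetric])
  have wm: "w1 = u1 + t1 * A1" "w2 = u2 + t2 * A2" "m1 = u1 - t1 * B1" "m2 = u2 - t2 * B2"
    unfolding w m A1_def A2_def B1_def B2_def by (rule refl)+
  have "(u - v)\<^sup>2 + ((u + a - b) - (v + c - d))\<^sup>2 - ((u + a) - (v + c))\<^sup>2 - ((u - b) - (v - d))\<^sup>2 =
      - 2 * (a - c) * (b - d)" for u v a b c d :: real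
    by algebra
  then have "(u1 - u2)\<^sup>2 + (f1 - f2)\<^sup>2 - (w1 - w2)\<^sup>2 - (m1 - m2)\<^sup>2 =
     - 2 * (t1 * A1 - t2 * A2) * (t1 * B1 - t2 * B2)"
    unfolding f' wm .
  also have "\<dots> = 2 * (t1 * t2) * (A1 * B2 + A2 * B1) - 2 * t1\<^sup>2 * (A1 * B1) - 2 * t2\<^sup>2 * (A2 * B2)"
    by algebra
  also have "\<dots> = 2 * (t1 * t2) * (A1 * B2 + A2 * B1)"
    by (simp only: AB(5,6) mult_zero_right diff_zero)
  finally have id: "(u1 - u2)\<^sup>2 + (f1 - f2)\<^sup>2 - (w1 - w2)\<^sup>2 - (m1 - m2)\<^sup>2 =
     2 * (t1 * t2) * (A1 * B2 + A2 * B1)" .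
  \<comment> \<open>Only ramps of opposite sign give a negative term. Then \<open>A1 * B2\<close> is
    at most 4 and vanishes unless \<open>A1 > 0\<close>, where \<open>e1 \<ge> 1\<close>; likewise
    for the other product. The prefactor 2 makes the constant 8.\<close>
  have "2 * (t1 * t2) * (A1 * B2 + A2 * B1) \<ge> - 8 * (e1 + e2)"
  proof (cases "t1 * t2 < 0")
    case False
    then have "0 \<le> 2 * (t1 * t2)" by simp
    then have "0 \<le> 2 * (t1 * t2) * (A1 * B2 + A2 * B1)"
      using AB(1-4) by (rule_tac mult_nonneg_nonneg[OF _ add_nonneg_nonneg[OF mult_nonneg_nonneg mult_nonneg_nonneg]])
    moreover have "- 8 * (e1 + e2) \<le> 0" using e by simp
    ultimately show ?thesis by (rule order_trans[rotated])
  next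
    case True
    have "A1 * B2 \<le> 4 * e1"
    proof (cases "r1 > s1 * u1")
      case r: True
      have "A1 * B2 \<le> 2 * 2" using AB(1-4,7-10) by (intro mult_mono) auto
      then show ?thesis using e1[OF True r] by linarith
    qed (use e in \<open>simp add: A1_def\<close>)
    moreover have "A2 * B1 \<le> 4 * e2"
    proof (cases "r2 > s2 * u2")
      case r: True
      have "A2 * B1 \<le> 2 * 2" using AB(1-4,7-10) by (intro mult_mono) auto
      then show ?thesis using e2[OF True r] by linarith
    qed (use e in \<open>simp add: A2_def\<close>)
    ultimately have X: "A1 * B2 + A2 * B1 \<le> 4 * (e1 + e2)" by simp
    have "\<bar>t1 * t2\<bar> \<le> 1" using t by (auto simp: abs_mult intro!: mult_le_one)
    then have "- (t1 * t2) * (A1 * B2 + A2 * B1) \<le> 1 * (4 * (e1 + e2))"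
      using X AB(1-4) e by (intro mult_mono) auto
    then have "2 * (- (t1 * t2) * (A1 * B2 + A2 * B1)) \<le> 2 * (4 * (e1 + e2))" by simp
    moreover have "2 * (t1 * t2) * (A1 * B2 + A2 * B1) = - (2 * (- (t1 * t2) * (A1 * B2 + A2 * B1)))"
      by simp
    ultimately show ?thesis by linarith
  qed
  then have "- 8 * (e1 + e2) \<le> (u1 - u2)\<^sup>2 + (f1 - f2)\<^sup>2 - (w1 - w2)\<^sup>2 - (m1 - m2)\<^sup>2"
    unfolding id .
  then show ?thesis by linarith
qed

section \<open>Energy of a minimizer in a smaller ball\<close>

lemma ramp_pos_imp: "0 < ramp s \<Longrightarrow> 1 < s"
  by (auto simp: ramp_def split: if_splits)

lemma ramp_neg_imp: "ramp s < 0 \<Longrightarrow> s < -1"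
  using ramp_pos_imp[of "- s"] by simp

text \<open>Nonzero ramps mean \<open>\<bar>gap\<bar> > 1\<close>, so gaps on opposite sides differ
  by more than 2 and by more than either absolute value, while \<open>gap\<close> is Lipschitz with
  constant 2.\<close>

lemma opposite_sides_far:
  assumes "ramp (gap x) * ramp (gap y) < 0"
  shows "\<bar>gap x\<bar> \<le> 2 * norm (x - y)" "1 \<le> norm (x - y)"
proof -
  have "1 < gap x \<and> gap y < -1 \<or> gap x < -1 \<and> 1 < gap y"
    using assms ramp_pos_imp ramp_neg_imp unfolding mult_less_0_iff by blast
  then show "\<bar>gap x\<bar> \<le> 2 * norm (x - y)" "1 \<le> norm (x - y)"
    using gap_lipschitz[of x y] by (elim disjE; linarith)+
qed

lemma transition_weight_eq_1:
  "x \<in> transition_set S (x - y) \<Longrightarrow> 1 \<le> norm (x - y) \<Longrightarrow> transition_weight S x y = 1"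
  by (simp add: transition_weight_def)

lemma transition_weight_near:
  "x \<in> transition_set S (x - y) \<Longrightarrow> norm (x - y) \<le> 1 \<Longrightarrow>
   transition_weight S x y = (norm (x - y))\<^sup>2"
  using abs_square_le_1[of "norm (x - y)"] by (simp add: transition_weight_def)

text \<open>Passing from \<open>x\<close> to \<open>y\<close> changes the gap by at most
  \<open>2 * norm (x - y)\<close> and the norm by at most \<open>norm (x - y)\<close>; these are
  exactly the margins built into \<open>transition_set\<close>.\<close>

lemma not_in_transition_set:
  assumes "x \<notin> transition_set S (x - y)" "norm x < S + 4"
  shows "2 < \<bar>gap x\<bar>" "2 < \<bar>gap y\<bar>" "norm x < S + 1" "norm y < S + 1" "sgn (gap x) = sgn (gap y)"
proof -
  have a: "\<bar>gap x\<bar> > 2 + 2 * norm (x - y)" "norm x < S + 1 - norm (x - y)"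
    using assms by (auto simp: transition_set_def not_le)
  show "2 < \<bar>gap x\<bar>" "norm x < S + 1" using a norm_ge_zero[of "x - y"] by linarith+
  show "2 < \<bar>gap y\<bar>" using a gap_lipschitz[of x y] by linarith
  show "sgn (gap x) = sgn (gap y)"
  proof (cases "0 < gap x")
    case True
    then have "0 < gap y" using a gap_lipschitz[of x y] by linarith
    then show ?thesis using True by simp
  next
    case False
    then have "gap x < 0" "gap y < 0"
      using a gap_lipschitz[of x y] norm_ge_zero[of "x - y"] by linarith+
    then show ?thesis by simp
  qed
  show "norm y < S + 1" using a norm_triangle_sub[of y x] by (simp add: norm_minus_commute)
qed

text \<open>A point where the cutoff is nonzero lies in the transition set for every displacement.
  The constant is the square of the Lipschitz constant 3.\<close>

lemma cutoff_diff_le: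
  fixes x y :: "'m::finite pt"
  shows "(cutoff S x - cutoff S y)\<^sup>2 \<le> 9 * (transition_weight S x y + transition_weight S y x)"
proof -
  have *: "(cutoff S x - cutoff S y)\<^sup>2 \<le> 9 * transition_weight S x y" if "cutoff S x \<noteq> 0" for x y :: "'m pt"
  proof -
    have "x \<in> transition_set S (x - y)"
      using cutoff_nonzero_imp[OF that] norm_ge_zero[of "x - y"] unfolding transition_set_def
      by (simp del: norm_ge_zero)
    then have t: "transition_weight S x y = min ((norm (x - y))\<^sup>2) 1"
      by (simp add: transition_weight_def)
    have "\<bar>cutoff S x - cutoff S y\<bar> \<le> 1" using cutoff_bounds[of S x] cutoff_bounds[of S y] by linarith
    then have "(cutoff S x - cutoff S y)\<^sup>2 \<le> 1" by (simp add: abs_square_le_1)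
    moreover have "(cutoff S x - cutoff S y)\<^sup>2 \<le> (3 * norm (x - y))\<^sup>2"
      using cutoff_lipschitz[of S x y] by (metis abs_ge_zero power2_abs power_mono)
    ultimately show ?thesis unfolding t by (simp add: min_def power_mult_distrib)
  qed
  consider "cutoff S x \<noteq> 0" | "cutoff S y \<noteq> 0" | "cutoff S x = 0" "cutoff S y = 0" by blast
  then show ?thesis
  proof cases
    case 1 then show ?thesis using *[OF 1, of y] transition_weight_nonneg[of S y x] by simp
  next
    case 2 then show ?thesis using *[OF 2, of x] transition_weight_nonneg[of S x y]
      by (simp add: power2_commute)
  next
    case 3 then show ?thesis using transition_weight_nonneg[of S x y] transition_weight_nonneg[of S y x] by simp
  qed
qed

text \<open>Allows each pair to be charged to whichever of its points lies in the relevant region,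
  at the cost of a factor 2.\<close>

lemma (in symmetric_kernel) kernel_integral_symmetrize:
  assumes [measurable]: "case_prod n \<in> borel_measurable (borel \<Otimes>\<^sub>M borel)"
    and "\<And>x y. 0 \<le> n x y" "\<And>x y. F x y \<le> n x y + n y x"
  shows "kernel_integral F \<le> 2 * kernel_integral n"
proof -
  have "kernel_integral F \<le> kernel_integral (\<lambda>x y. n x y + n y x)"
    using assms by (intro kernel_integral_mono) auto
  also have "\<dots> = kernel_integral n + kernel_integral (\<lambda>x y. n y x)"
  proof (rule kernel_integral_add)
    show "case_prod (\<lambda>x y. n y x) \<in> borel_measurable (borel \<Otimes>\<^sub>M borel)" by measurable
  qed (use assms(1,2) in auto)
  also have "\<dots> = 2 * kernel_integral n"
    using kernel_integral_swap[OF assms(1)] by (simp only: mult_2)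
  finally show ?thesis .
qed

lemma ennreal_le_of_eighth_le:
  assumes "ennreal (1/2) * A / 4 \<le> ennreal b" "0 \<le> b"
  shows "A \<le> ennreal (8 * b)"
proof (cases A)
  case (real r)
  have "ennreal (1/2) * A = ennreal (1/2 * r)"
    unfolding real(2) by (rule ennreal_mult'[symmetric]) simp
  then have "ennreal (1/2) * A / 4 = ennreal (1/2 * r / 4)"
    using divide_ennreal[of "1/2 * r" 4] real(1) by simp
  then have "1/2 * r / 4 \<le> b" using assms by simp
  then show ?thesis using real by (simp add: ennreal_leI)
next
  case top
  then show ?thesis using assms by (simp add: ennreal_mult_top ennreal_top_divide top_unique)
qed

lemma ennreal_half_eq: "(A::ennreal) / 2 = 2 * (A / 4)"
  using ennreal_two_times_divide_4[of A] by (simp only: ennreal_times_divide)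

section \<open>Energy estimates for a minimizer with values in [-1, 1]\<close>

text \<open>\<open>X\<close> measures interaction costs and will be a multiple of
  \<open>S ^ (2m - 1) * energy_rate \<gamma> S\<close>. \<open>Gm * V\<close> measures potential
  costs, with \<open>V\<close> a multiple of \<open>S ^ (2m - 1)\<close>.\<close>

locale bounded_odd_minimizer = odd_minimizer k K G R u U
  for k :: "'m::finite pt \<Rightarrow> real" and K G R u U +
  fixes S Gm X V :: real
  assumes U_le_1: "\<bar>U x\<bar> \<le> 1" and S_ge: "2 \<le> S" and R_gt: "S + 4 < R"
    and G_le: "\<bar>t\<bar> \<le> 1 \<Longrightarrow> G t \<le> Gm" and G_wells: "G 1 = 0" "G (-1) = 0"
    and transition_weight_integral: "kernel_integral (transition_weight S) \<le> ennreal X"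
    and transition_volume: "emeasure lborel (transition_set S (0 :: 'm pt)) \<le> ennreal V"
    and X_nonneg: "0 \<le> X" and V_nonneg: "0 \<le> V"
begin

lemma Gm_nonneg: "0 \<le> Gm"
  using G_le[of 0] G_nonneg[of 0] by linarith

lemma potential_transition_le:
  assumes "\<And>x. x \<notin> transition_set S 0 \<Longrightarrow> q x = 0" "\<And>x. q x \<le> Gm"
  shows "(\<integral>\<^sup>+x\<in>ball (0::'m pt) R. ennreal (q x) \<partial>lborel) \<le> ennreal (Gm * V)"
proof -
  have "(\<integral>\<^sup>+x\<in>ball (0::'m pt) R. ennreal (q x) \<partial>lborel) \<le>
     (\<integral>\<^sup>+x. ennreal Gm * indicator (transition_set S 0) (x::'m pt) \<partial>lborel)"
  proof (rule nn_integral_mono)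
    fix x :: "'m pt"
    show "ennreal (q x) * indicator (ball 0 R) x \<le> ennreal Gm * indicator (transition_set S 0) x"
      using assms(1)[of x] ennreal_leI[OF assms(2)[of x]] by (auto split: split_indicator)
  qed
  also have "\<dots> = ennreal Gm * emeasure lborel (transition_set S (0::'m pt))"
    by (rule nn_integral_cmult_indicator) simp
  also have "\<dots> \<le> ennreal Gm * ennreal V" by (intro mult_left_mono transition_volume) simp
  also have "\<dots> = ennreal (Gm * V)" using Gm_nonneg by (simp add: ennreal_mult')
  finally show ?thesis .
qed

lemma caccioppoli:
  "kernel_integral (\<lambda>x y. (cutoff S x * U x - cutoff S y * U y)\<^sup>2) \<le> ennreal (54 * X + 8 * (Gm * V))"
proof -
  let ?z = "cutoff S :: 'm pt \<Rightarrow> real" and ?w = "\<lambda>x. (1 - (cutoff S x)\<^sup>2 / 2) * U x"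
  let ?F = "\<lambda>x y. (?z x * U x - ?z y * U y)\<^sup>2" and ?q = "\<lambda>x. if ?z x = 0 then 0 else Gm"
  have w_le: "\<bar>?w x\<bar> \<le> 1" for x
  proof -
    have "0 \<le> (?z x)\<^sup>2" "(?z x)\<^sup>2 \<le> 1" using cutoff_bounds[of S x] by (auto simp: abs_square_le_1)
    then have "\<bar>1 - (?z x)\<^sup>2 / 2\<bar> \<le> 1" by auto
    then show ?thesis unfolding abs_mult using U_le_1[of x] by (intro mult_le_one) auto
  qed
  have "kernel_integral (\<lambda>x y. 1/2 * ?F x y) / 4 + (\<integral>\<^sup>+x\<in>ball (0::'m pt) R. ennreal 0 \<partial>lborel) \<le>
     kernel_integral (\<lambda>x y. 3/2 * (?z x - ?z y)\<^sup>2) / 4 + (\<integral>\<^sup>+x\<in>ball 0 R. ennreal (?q x) \<partial>lborel)"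
  proof (rule comparison[where w = ?w and P = "\<lambda>x y. 1/2 * ?F x y" and p = "\<lambda>_. 0"
        and N = "\<lambda>x y. 3/2 * (?z x - ?z y)\<^sup>2" and q = ?q])
    let ?c = "\<lambda>a b. (1 - \<bar>ramp (a - b)\<bar>) * max 0 (min 1 (S + 4 - sqrt (a\<^sup>2 + b\<^sup>2)))"
    \<comment> \<open>The factor in front of \<open>U\<close> is unchanged when \<open>x'\<close>
      and \<open>x''\<close> are exchanged, because \<open>ramp\<close> enters through its absolute
      value.\<close>
    show "ae_doubly_radial_odd ?w"
    proof (rule ae_doubly_radial_odd_compose[OF ae_doubly_radial_odd_U, where \<Phi> = "\<lambda>a b t. (1 - (?c a b)\<^sup>2 / 2) * t"])
      fix a b t :: real
      have "ramp (b - a) = - ramp (a - b)" by (metis minus_diff_eq ramp_minus)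
      then show "(1 - (?c b a)\<^sup>2 / 2) * - t = - ((1 - (?c a b)\<^sup>2 / 2) * t)"
        by (simp add: add.commute)
    qed (simp add: cutoff_def gap_def norm_pair_eq)
    show "?w x = 0" if "x \<notin> ball 0 R" for x using U_outside[OF that] by simp
    show "\<bar>?w x\<bar> \<le> 1" for x by (rule w_le)
    show "(?w x - ?w y)\<^sup>2 + 1/2 * ?F x y \<le> (U x - U y)\<^sup>2 + 3/2 * (?z x - ?z y)\<^sup>2" for x y
      by (rule caccioppoli_pointwise) (auto simp: U_le_1 cutoff_bounds)
    show "G (?w x) + 0 \<le> G (U x) + ?q x" for x
    proof (cases "?z x = 0")
      case False
      then have "?q x = Gm" by simp
      then show ?thesis using G_le[OF w_le[of x]] G_nonneg[of "U x"] by linarith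
    qed simp
  qed (auto simp: Gm_nonneg)
  \<comment> \<open>\<open>27 = 2 * (3/2 * 9)\<close>: the pointwise constant, the constant of
    \<open>cutoff_diff_le\<close>, and the doubling by symmetrization.\<close>
  also have "kernel_integral (\<lambda>x y. 3/2 * (?z x - ?z y)\<^sup>2) \<le> ennreal (27 * X)"
  proof -
    have "kernel_integral (\<lambda>x y. 3/2 * (?z x - ?z y)\<^sup>2) \<le>
       2 * kernel_integral (\<lambda>x y. 27/2 * transition_weight S x y)"
    proof (rule kernel_integral_symmetrize)
      show "3/2 * (?z x - ?z y)\<^sup>2 \<le> 27/2 * transition_weight S x y + 27/2 * transition_weight S y x" for x y
        using cutoff_diff_le[of S x y] by (simp add: algebra_simps)
    qed (auto simp: transition_weight_nonneg)
    also have "\<dots> = 2 * (ennreal (27/2) * kernel_integral (transition_weight S))"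
      by (subst kernel_integral_cmult) auto
    also have "\<dots> \<le> 2 * (ennreal (27/2) * ennreal X)"
      by (intro mult_left_mono transition_weight_integral) auto
    also have "2 * (ennreal (27/2) * ennreal X) = ennreal (27 * X)"
      using X_nonneg ennreal_mult'[of "27/2" X] ennreal_mult'[of 2 "27/2 * X"] by simp
    finally show ?thesis .
  qed
  also have "ennreal (27 * X) / 4 = ennreal (27 * X / 4)"
    using divide_ennreal[of "27 * X" 4] X_nonneg by simp
  also have "(\<integral>\<^sup>+x\<in>ball (0::'m pt) R. ennreal (?q x) \<partial>lborel) \<le> ennreal (Gm * V)"
  proof (rule potential_transition_le)
    fix x :: "'m pt"
    show "x \<notin> transition_set S 0 \<Longrightarrow> ?q x = 0"
      using cutoff_nonzero_imp[of S x] by (auto simp: transition_set_def)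
    show "?q x \<le> Gm" using Gm_nonneg by simp
  qed
  finally have "kernel_integral (\<lambda>x y. 1/2 * ?F x y) / 4 \<le> ennreal (27 * X / 4) + ennreal (Gm * V)"
    by (simp add: divide_right_mono_ennreal add_mono)
  also have "\<dots> = ennreal (27 * X / 4 + Gm * V)"
    using X_nonneg V_nonneg Gm_nonneg by simp
  also have "kernel_integral (\<lambda>x y. 1/2 * ?F x y) = ennreal (1/2) * kernel_integral ?F"
    by (rule kernel_integral_cmult) auto
  \<comment> \<open>The factor 8 undoes the \<open>1/2\<close> and the division by 4 on the
    left.\<close>
  finally have "kernel_integral ?F \<le> ennreal (8 * (27 * X / 4 + Gm * V))"
    using X_nonneg V_nonneg Gm_nonneg by (intro ennreal_le_of_eighth_le) auto
  then show ?thesis by (simp add: algebra_simps)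
qed

text \<open>In the region \<open>gap > 0\<close> the three functions are \<open>\<phi>\<close>, \<open>max U \<phi>\<close> and \<open>min U \<phi>\<close>; on the
  other side of the cone the roles of \<open>max\<close> and \<open>min\<close> are exchanged. Near the cone \<open>\<phi> = U\<close>.\<close>

definition \<phi> :: "'m pt \<Rightarrow> real" where
  "\<phi> x = (1 - \<bar>ramp (gap x)\<bar>) * U x + ramp (gap x) * level S (norm x)"

definition upper :: "'m pt \<Rightarrow> real" where
  "upper x = U x + ramp (gap x) * max 0 (level S (norm x) - sgn (gap x) * U x)"

definition lower :: "'m pt \<Rightarrow> real" where
  "lower x = U x - ramp (gap x) * max 0 (sgn (gap x) * U x - level S (norm x))"

lemma measurable_competitors [measurable]:
  "\<phi> \<in> borel_measurable borel" "upper \<in> borel_measurable borel" "lower \<in> borel_measurable borel"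
  unfolding \<phi>_def[abs_def] upper_def[abs_def] lower_def[abs_def] by measurable

lemma abs_sgn_mult_U: "\<bar>sgn (gap x) * U x\<bar> \<le> 1"
  using U_le_1[of x] by (auto simp: sgn_if)

text \<open>\<open>\<phi> - U\<close> is \<open>ramp (gap x)\<close> times a difference whose
  positive part enters \<open>upper\<close> and whose negative part enters \<open>lower\<close>.
  Hence potential energies are exchanged without loss:
  \<open>G (upper x) + G (lower x) = G (U x) + G (\<phi> x)\<close>.\<close>

lemma upper_lower: "upper x = U x \<and> lower x = \<phi> x \<or> upper x = \<phi> x \<and> lower x = U x"
proof -
  have *: "ramp (gap x) * (sgn (gap x) * U x) = \<bar>ramp (gap x)\<bar> * U x"
    using ramp_eq_sgn_mult[of "gap x"] by (cases "gap x" "0::real" rule: linorder_cases) auto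
  have "\<phi> x = U x + ramp (gap x) * (level S (norm x) - sgn (gap x) * U x)"
    unfolding \<phi>_def right_diff_distrib left_diff_distrib * by simp
  then show ?thesis
    unfolding upper_def lower_def
    by (cases "level S (norm x) \<le> sgn (gap x) * U x") (auto simp: right_diff_distrib)
qed

lemma abs_phi_le_1: "\<bar>\<phi> x\<bar> \<le> 1"
proof -
  let ?t = "\<bar>ramp (gap x)\<bar>"
  have t: "0 \<le> ?t" "?t \<le> 1" using abs_ramp_le_1[of "gap x"] by auto
  have "\<bar>\<phi> x\<bar> \<le> \<bar>(1 - ?t) * U x\<bar> + \<bar>ramp (gap x) * level S (norm x)\<bar>"
    unfolding \<phi>_def by (rule abs_triangle_ineq)
  also have "\<dots> = (1 - ?t) * \<bar>U x\<bar> + ?t * \<bar>level S (norm x)\<bar>"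
    using t by (simp add: abs_mult)
  also have "\<dots> \<le> (1 - ?t) * 1 + ?t * 1"
    using t U_le_1 abs_level_le_1 by (intro add_mono mult_left_mono) auto
  finally show ?thesis by simp
qed

lemma abs_upper_le_1: "\<bar>upper x\<bar> \<le> 1"
  using upper_lower[of x] abs_phi_le_1[of x] U_le_1[of x] by metis

text \<open>The level is \<open>-1\<close> there, the least value possible for
  \<open>sgn (gap x) * U x\<close>; this is where the bound on \<open>U\<close> enters.\<close>

lemma upper_outside: "S + 2 \<le> norm x \<Longrightarrow> upper x = U x"
  using abs_sgn_mult_U[of x] by (simp add: upper_def level_def)

lemma lower_inside: "norm x \<le> S + 1 \<Longrightarrow> lower x = U x"
  using abs_sgn_mult_U[of x] by (simp add: lower_def level_def)

lemma phi_eq_sgn: "2 < \<bar>gap x\<bar> \<Longrightarrow> norm x < S + 1 \<Longrightarrow> \<phi> x = sgn (gap x)"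
  using ramp_eq_sgn[of "gap x"] by (auto simp: \<phi>_def level_def abs_sgn_eq)

lemma ae_doubly_radial_odd_upper: "ae_doubly_radial_odd upper"
proof (rule ae_doubly_radial_odd_compose[OF ae_doubly_radial_odd_U, where \<Phi> =
    "\<lambda>a b t. t + ramp (a - b) * max 0 (level S (sqrt (a\<^sup>2 + b\<^sup>2)) - sgn (a - b) * t)"])
  fix a b t :: real
  have r: "ramp (b - a) = - ramp (a - b)" by (metis minus_diff_eq ramp_minus)
  have s: "sgn (b - a) = - sgn (a - b)" by (metis minus_diff_eq sgn_minus)
  show "- t + ramp (b - a) * max 0 (level S (sqrt (b\<^sup>2 + a\<^sup>2)) - sgn (b - a) * - t) =
     - (t + ramp (a - b) * max 0 (level S (sqrt (a\<^sup>2 + b\<^sup>2)) - sgn (a - b) * t))"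
    unfolding r s by (simp add: add.commute)
qed (simp add: upper_def gap_def norm_pair_eq)

text \<open>Bounds the defect of submodularity for a pair of points on opposite sides of the cone.\<close>

definition excess :: "'m pt \<Rightarrow> 'm pt \<Rightarrow> real" where
  "excess x y = (if norm x < S + 2 \<and> \<bar>gap x\<bar> \<le> 2 * norm (x - y) \<and> 1 \<le> norm (x - y) then 1 else 0)"

lemma measurable_excess [measurable]: "case_prod excess \<in> borel_measurable (borel \<Otimes>\<^sub>M borel)"
  unfolding excess_def by measurable

lemma excess_nonneg: "0 \<le> excess x y"
  by (simp add: excess_def)

lemma excess_le: "excess x y \<le> transition_weight S x y"
proof (cases "norm x < S + 2 \<and> \<bar>gap x\<bar> \<le> 2 * norm (x - y) \<and> 1 \<le> norm (x - y)")
  case True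
  then have "x \<in> transition_set S (x - y)" by (simp add: transition_set_def)
  then show ?thesis using True transition_weight_eq_1[of x S y] by (simp add: excess_def)
next
  case False
  then have "excess x y = 0" unfolding excess_def by (rule if_not_P)
  then show ?thesis using transition_weight_nonneg[of S x y] by simp
qed

text \<open>Beyond radius \<open>S + 2\<close> one has \<open>upper = U\<close> and
  \<open>lower = \<phi>\<close>, so pairs with both points there cancel. Dropping them confines the
  estimate to a bounded region, although \<open>\<phi>\<close> does not vanish at infinity.\<close>

definition near :: "'m pt \<Rightarrow> 'm pt \<Rightarrow> real" where
  "near x y = (if norm x < S + 2 \<or> norm y < S + 2 then 1 else 0)"

lemma measurable_near [measurable]: "case_prod near \<in> borel_measurable (borel \<Otimes>\<^sub>M borel)"
  unfolding near_def by measurable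

lemma competitor_le:
  "(upper x - upper y)\<^sup>2 + near x y * (lower x - lower y)\<^sup>2 \<le>
   (U x - U y)\<^sup>2 + (near x y * (\<phi> x - \<phi> y)\<^sup>2 + 8 * (excess x y + excess y x))"
proof (cases "norm x < S + 2 \<or> norm y < S + 2")
  case False
  then show ?thesis using excess_nonneg[of x y] excess_nonneg[of y x]
    by (simp add: near_def upper_outside)
next
  case True
  \<comment> \<open>A defect at \<open>x\<close> requires the level to exceed
    \<open>sgn (gap x) * U x\<close>. This is impossible where the level is \<open>-1\<close>, so
    \<open>x\<close> has norm less than \<open>S + 2\<close>.\<close>
  have ex: "1 \<le> excess x y"
    if "ramp (gap x) * ramp (gap y) < 0" "level S (norm x) > sgn (gap x) * U x" for x y
  proof -
    have "norm x < S + 2"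
    proof (rule ccontr)
      assume "\<not> norm x < S + 2"
      then have "level S (norm x) = -1" by (simp add: level_def)
      then show False using that(2) abs_sgn_mult_U[of x] by linarith
    qed
    then show ?thesis using opposite_sides_far[OF that(1)] by (simp add: excess_def)
  qed
  have "(upper x - upper y)\<^sup>2 + (lower x - lower y)\<^sup>2 \<le>
     (U x - U y)\<^sup>2 + ((\<phi> x - \<phi> y)\<^sup>2 + 8 * (excess x y + excess y x))"
  proof (rule competitor_pointwise[OF U_le_1 U_le_1 abs_level_le_1 abs_level_le_1
        abs_ramp_le_1 abs_ramp_le_1 ramp_eq_sgn_mult ramp_eq_sgn_mult])
    show "sgn (gap x) \<in> {-1, 0, 1}" "sgn (gap y) \<in> {-1, 0, 1}" by (auto simp: sgn_if)
    show "1 \<le> excess x y" if "ramp (gap x) * ramp (gap y) < 0" "sgn (gap x) * U x < level S (norm x)"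
      using ex that by blast
    show "1 \<le> excess y x" if "ramp (gap x) * ramp (gap y) < 0" "sgn (gap y) * U y < level S (norm y)"
      using ex[of y x] that by (simp add: mult.commute)
  qed (rule upper_def lower_def \<phi>_def excess_nonneg)+
  then show ?thesis using True by (simp add: near_def)
qed

text \<open>Off the transition set \<open>\<phi>\<close> takes the same value at both points. For
  distant pairs the squared increment is at most 4. For close pairs \<open>\<phi>\<close> is
  \<open>cutoff S x * U x\<close> plus \<open>profile\<close>, and \<open>32 = 2 * 4^2\<close> comes
  from the Lipschitz constant of the profile.\<close>

lemma phi_increment_le:
  assumes x: "norm x < S + 2"
  shows "(\<phi> x - \<phi> y)\<^sup>2 \<le>
    2 * (cutoff S x * U x - cutoff S y * U y)\<^sup>2 + 32 * transition_weight S x y"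
proof (cases "x \<in> transition_set S (x - y)")
  case False
  note far = not_in_transition_set[OF False]
  have "\<phi> x = \<phi> y" using far x phi_eq_sgn[of x] phi_eq_sgn[of y] by simp
  then show ?thesis using transition_weight_nonneg[of S x y] by simp
next
  case inside: True
  show ?thesis
  proof (cases "1 \<le> norm (x - y)")
    case True
    have "\<bar>\<phi> x - \<phi> y\<bar> \<le> 2" using abs_phi_le_1[of x] abs_phi_le_1[of y] by linarith
    then have "(\<phi> x - \<phi> y)\<^sup>2 \<le> 4" using power_mono[of "\<bar>\<phi> x - \<phi> y\<bar>" 2 2] by simp
    moreover have "0 \<le> (cutoff S x * U x - cutoff S y * U y)\<^sup>2" by simp
    ultimately show ?thesis using transition_weight_eq_1[OF inside True] by linarith
  next
    case False
    then have w: "transition_weight S x y = (norm (x - y))\<^sup>2"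
      using transition_weight_near[OF inside] by simp
    \<comment> \<open>Up to this radius the radial factor of the cutoff equals 1, so the
      decomposition of \<open>\<phi>\<close> is exact at both points.\<close>
    have y: "norm y < S + 3"
      using x False norm_triangle_sub[of y x] by (simp add: norm_minus_commute)
    have eq: "\<phi> v = cutoff S v * U v + profile S v" if "norm v < S + 3" for v
      using that by (simp add: \<phi>_def cutoff_def profile_def)
    let ?a = "cutoff S x * U x - cutoff S y * U y" and ?b = "profile S x - profile S y"
    have "\<phi> x - \<phi> y = ?a + ?b" using eq[of x] eq[of y] x y by simp
    then have "(\<phi> x - \<phi> y)\<^sup>2 \<le> 2 * ?a\<^sup>2 + 2 * ?b\<^sup>2"
      using sum_squares_bound[of ?a ?b] by (simp add: power2_sum)
    moreover have "?b\<^sup>2 \<le> (4 * norm (x - y))\<^sup>2"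
      using power_mono[OF profile_lipschitz[of S x y], of 2] by simp
    ultimately show ?thesis unfolding w by (simp add: power_mult_distrib)
  qed
qed

text \<open>\<open>upper\<close> is admissible because it equals \<open>U\<close> beyond
  \<open>S + 2 < R\<close>. Comparing it with \<open>U\<close> leaves the localized energy of
  \<open>lower\<close> on the left, bounded by that of \<open>\<phi>\<close> plus the
  excess.\<close>

lemma lower_energy_le:
  "kernel_integral (\<lambda>x y. near x y * (lower x - lower y)\<^sup>2) / 4 +
     (\<integral>\<^sup>+x\<in>ball 0 R. ennreal (if norm x < S + 2 then G (lower x) else 0) \<partial>lborel)
   \<le> ennreal (74 * X + 9 * (Gm * V))"
proof -
  let ?N = "\<lambda>x y. near x y * (\<phi> x - \<phi> y)\<^sup>2 + 8 * (excess x y + excess y x)"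
  let ?p = "\<lambda>x. if norm x < S + 2 then G (lower x) else 0"
  let ?q = "\<lambda>x. if norm x < S + 2 then G (\<phi> x) else 0"
  let ?Z = "\<lambda>x y. (cutoff S x * U x - cutoff S y * U y)\<^sup>2"
  \<comment> \<open>Half of the symmetric term \<open>4 * ?Z x y\<close> goes to each order of the
    points, and \<open>40 = 32 + 8\<close> collects the increment of \<open>\<phi>\<close> and the
    excess.\<close>
  let ?n = "\<lambda>x y. 2 * ?Z x y + 40 * transition_weight S x y"
  have near_nonneg: "0 \<le> near x y" for x y by (simp add: near_def)
  have "kernel_integral (\<lambda>x y. near x y * (lower x - lower y)\<^sup>2) / 4 +
      (\<integral>\<^sup>+x\<in>ball 0 R. ennreal (?p x) \<partial>lborel) \<le>
    kernel_integral ?N / 4 + (\<integral>\<^sup>+x\<in>ball 0 R. ennreal (?q x) \<partial>lborel)"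
  proof (rule comparison[where w = upper and N = ?N and p = ?p and q = ?q
        and P = "\<lambda>x y. near x y * (lower x - lower y)\<^sup>2"])
    show "upper x = 0" if "x \<notin> ball 0 R" for x
      using that R_gt upper_outside[of x] U_outside[of x] by simp
    show "(upper x - upper y)\<^sup>2 + near x y * (lower x - lower y)\<^sup>2 \<le> (U x - U y)\<^sup>2 + ?N x y" for x y
      by (rule competitor_le)
    show "G (upper x) + ?p x \<le> G (U x) + ?q x" for x
      using upper_lower[of x] upper_outside[of x] by (auto simp: not_less)
    show "0 \<le> ?N x y" for x y
      using near_nonneg excess_nonneg by (intro add_nonneg_nonneg mult_nonneg_nonneg) auto
    show "0 \<le> near x y * (lower x - lower y)\<^sup>2" for x y using near_nonneg by simp
  qed (auto simp: abs_upper_le_1 ae_doubly_radial_odd_upper)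
  also have "kernel_integral ?N \<le> 2 * kernel_integral ?n"
  proof (rule kernel_integral_symmetrize)
    show "0 \<le> ?n x y" for x y using transition_weight_nonneg[of S x y] by simp
    fix x y
    have b: "(\<phi> x - \<phi> y)\<^sup>2 \<le> 2 * ?Z x y + 32 * transition_weight S x y" if "norm x < S + 2" for x y
      by (rule phi_increment_le[OF that])
    have z: "0 \<le> ?Z x y" "?Z y x = ?Z x y" by (auto simp: power2_commute)
    have n: "near x y * (\<phi> x - \<phi> y)\<^sup>2 \<le>
        4 * ?Z x y + 32 * transition_weight S x y + 32 * transition_weight S y x"
    proof -
      consider "norm x < S + 2" | "norm y < S + 2" | "\<not> norm x < S + 2" "\<not> norm y < S + 2" by blast
      then show ?thesis
      proof cases
        case 1
        then have "near x y * (\<phi> x - \<phi> y)\<^sup>2 = (\<phi> x - \<phi> y)\<^sup>2" by (simp add: near_def)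
        then show ?thesis using b[OF 1, of y] z transition_weight_nonneg[of S y x] by linarith
      next
        case 2
        then have "near x y * (\<phi> x - \<phi> y)\<^sup>2 = (\<phi> y - \<phi> x)\<^sup>2" by (simp add: near_def power2_commute)
        then show ?thesis using b[OF 2, of x] z transition_weight_nonneg[of S x y] by linarith
      next
        case 3
        then have "near x y * (\<phi> x - \<phi> y)\<^sup>2 = 0" by (simp add: near_def)
        then show ?thesis using z transition_weight_nonneg[of S x y] transition_weight_nonneg[of S y x] by linarith
      qed
    qed
    show "?N x y \<le> ?n x y + ?n y x"
    proof -
      have "a + 8 * (e1 + e2) \<le> 2 * c + 40 * t1 + (2 * c + 40 * t2)"
        if "a \<le> 4 * c + 32 * t1 + 32 * t2" "e1 \<le> t1" "e2 \<le> t2" for a c t1 t2 e1 e2 :: real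
        using that by (simp add: algebra_simps)
      from this[OF n excess_le excess_le] show ?thesis unfolding z(2) .
    qed
  qed measurable
  also have "kernel_integral ?n = ennreal 2 * kernel_integral ?Z + ennreal 40 * kernel_integral (transition_weight S)"
    by (subst kernel_integral_add) (auto simp: transition_weight_nonneg kernel_integral_cmult)
  also have "\<dots> \<le> ennreal 2 * ennreal (54 * X + 8 * (Gm * V)) + ennreal 40 * ennreal X"
    by (intro add_mono mult_left_mono caccioppoli transition_weight_integral) auto
  also have "\<dots> = ennreal (148 * X + 16 * (Gm * V))"
    using X_nonneg V_nonneg Gm_nonneg
    ennreal_mult'[of 2 "54 * X + 8 * (Gm * V)"] ennreal_mult'[of 40 X]
      ennreal_plus[of "2 * (54 * X + 8 * (Gm * V))" "40 * X"]
    by (simp only: mult_nonneg_nonneg add_nonneg_nonneg zero_le_numeral) (simp add: algebra_simps)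
  also have "2 * ennreal (148 * X + 16 * (Gm * V)) / 4 = ennreal (74 * X + 8 * (Gm * V))"
  proof -
    have "2 * ennreal (148 * X + 16 * (Gm * V)) = ennreal (2 * (148 * X + 16 * (Gm * V)))"
      by (subst ennreal_mult') auto
    also have "\<dots> / 4 = ennreal (2 * (148 * X + 16 * (Gm * V)) / 4)"
      using divide_ennreal[of "2 * (148 * X + 16 * (Gm * V))" 4] X_nonneg V_nonneg Gm_nonneg by simp
    also have "2 * (148 * X + 16 * (Gm * V)) / 4 = 74 * X + 8 * (Gm * V)"
      by (simp add: field_simps)
    finally show ?thesis .
  qed
  also have "(\<integral>\<^sup>+x\<in>ball 0 R. ennreal (?q x) \<partial>lborel) \<le> ennreal (Gm * V)"
  proof (rule potential_transition_le)
    fix x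
    show "?q x \<le> Gm" using G_le[OF abs_phi_le_1[of x]] Gm_nonneg by simp
    \<comment> \<open>Within radius \<open>S + 2\<close> such a point has
      \<open>\<bar>gap x\<bar> > 2\<close> and \<open>norm x < S + 1\<close>, so
      \<open>\<phi>\<close> sits at a well of \<open>G\<close>.\<close>
    assume "x \<notin> transition_set S 0"
    then have "\<phi> x = sgn (gap x) \<and> gap x \<noteq> 0" if "norm x < S + 2"
      using that phi_eq_sgn[of x] by (auto simp: transition_set_def not_le)
    then show "?q x = 0" using G_wells by (auto simp: sgn_if)
  qed
  finally have "kernel_integral (\<lambda>x y. near x y * (lower x - lower y)\<^sup>2) / 4 +
      (\<integral>\<^sup>+x\<in>ball 0 R. ennreal (?p x) \<partial>lborel) \<le> ennreal (74 * X + 8 * (Gm * V)) + ennreal (Gm * V)"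
    by (auto simp: divide_right_mono_ennreal add_mono mult_left_mono)
  also have "\<dots> = ennreal (74 * X + 9 * (Gm * V))"
    using X_nonneg V_nonneg Gm_nonneg by (subst ennreal_plus[symmetric]) auto
  finally show ?thesis .
qed

text \<open>\<open>lower\<close> equals \<open>U\<close> up to radius \<open>S + 1\<close>, so its
  energy controls that of \<open>U\<close> except for pairs reaching from inside radius
  \<open>S\<close> to beyond \<open>S + 1\<close>.\<close>

lemma energy_ball_le: "energy K G u (ball 0 S) \<le> ennreal (150 * X + 18 * (Gm * V))"
proof -
  let ?P = "\<lambda>x y. near x y * (lower x - lower y)\<^sup>2"
  let ?A = "kernel_integral ?P"
  let ?Q = "\<integral>\<^sup>+x\<in>ball 0 R. ennreal (if norm x < S + 2 then G (lower x) else 0) \<partial>lborel"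
  have "energy K G u (ball 0 S) \<le> kernel_integral (\<lambda>x y. indicator (ball 0 S) x * (U x - U y)\<^sup>2) / 2 +
     (\<integral>\<^sup>+x\<in>ball 0 S. ennreal (G (U x)) \<partial>lborel)"
    by (rule energy_le[OF measurable_U _ K_AE u_AE]) simp
  also have "(\<integral>\<^sup>+x\<in>ball 0 S. ennreal (G (U x)) \<partial>lborel) \<le> ?Q"
  proof (rule nn_integral_mono)
    fix x :: "'m pt"
    show "ennreal (G (U x)) * indicator (ball 0 S) x \<le>
        ennreal (if norm x < S + 2 then G (lower x) else 0) * indicator (ball 0 R) x"
      using lower_inside[of x] R_gt by (auto split: split_indicator)
  qed
  also have "kernel_integral (\<lambda>x y. indicator (ball 0 S) x * (U x - U y)\<^sup>2) \<le>
      kernel_integral (\<lambda>x y. ?P x y + 4 * transition_weight S x y)"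
  proof (rule kernel_integral_mono)
    fix x y
    have P: "0 \<le> ?P x y" by (simp add: near_def)
    note t = transition_weight_nonneg[of S x y]
    show "indicator (ball 0 S) x * (U x - U y)\<^sup>2 \<le> ?P x y + 4 * transition_weight S x y"
    proof (cases "norm x < S")
      case False
      then show ?thesis using P t by simp
    next
      case x: True
      show ?thesis
      proof (cases "norm y \<le> S + 1")
        case True
        then have "?P x y = (U x - U y)\<^sup>2" using x lower_inside by (simp add: near_def)
        then show ?thesis using x t by simp
      next
        case False
        have tri: "norm y \<le> norm x + norm (x - y)"
          using norm_triangle_sub[of y x] by (simp add: norm_minus_commute)
        \<comment> \<open>The unit margin between the two radii makes these pairs long, so the
          weight is 1 and the increment bound \<open>2^2\<close> is \<open>4\<close> times
          it.\<close>
        have "x \<in> transition_set S (x - y)" "1 \<le> norm (x - y)"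
          using tri x False by (auto simp: transition_set_def)
        then have "transition_weight S x y = 1" by (rule transition_weight_eq_1)
        moreover have "(U x - U y)\<^sup>2 \<le> 2\<^sup>2"
        proof -
          have "\<bar>U x - U y\<bar> \<le> 2" using U_le_1[of x] U_le_1[of y] by linarith
          then show ?thesis by (metis abs_ge_zero power2_abs power_mono)
        qed
        ultimately show ?thesis using x P by simp
      qed
    qed
  qed
  also have "\<dots> = ?A + ennreal 4 * kernel_integral (transition_weight S)"
    by (subst kernel_integral_add) (auto simp: transition_weight_nonneg kernel_integral_cmult near_def)
  also have "\<dots> \<le> ?A + ennreal 4 * ennreal X"
    by (intro add_mono mult_left_mono transition_weight_integral) auto
  also have "(?A + ennreal 4 * ennreal X) / 2 = 2 * (?A / 4) + ennreal (2 * X)"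
  proof -
    have "ennreal 4 * ennreal X = ennreal (4 * X)" by (subst ennreal_mult') auto
    moreover have "ennreal (4 * X) / 2 = ennreal (2 * X)"
      using divide_ennreal[of "4 * X" 2] X_nonneg by simp
    ultimately show ?thesis by (simp only: add_divide_distrib_ennreal ennreal_half_eq[of ?A])
  qed
  finally have "energy K G u (ball 0 S) \<le> 2 * (?A / 4) + ennreal (2 * X) + ?Q"
    by (auto simp: divide_right_mono_ennreal add_mono)
  \<comment> \<open>The potential part is doubled as well, to match the form of
    \<open>lower_energy_le\<close>.\<close>
  also have "\<dots> \<le> 2 * (?A / 4 + ?Q) + ennreal (2 * X)"
    by (simp add: distrib_left mult_2 ac_simps add_increasing)
  also have "\<dots> \<le> 2 * ennreal (74 * X + 9 * (Gm * V)) + ennreal (2 * X)"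
    by (intro add_mono mult_left_mono lower_energy_le) auto
  also have "2 * ennreal (74 * X + 9 * (Gm * V)) = ennreal (2 * (74 * X + 9 * (Gm * V)))"
    by (subst ennreal_mult') auto
  also have "ennreal (2 * (74 * X + 9 * (Gm * V))) + ennreal (2 * X) = ennreal (150 * X + 18 * (Gm * V))"
    using X_nonneg V_nonneg Gm_nonneg by (subst ennreal_plus[symmetric]) (auto simp: algebra_simps)
  finally show ?thesis .
qed

end

section \<open>Bounds on the potential, representatives of the minimizer, and conclusion\<close>

lemma abs_le_C2_norm:
  assumes "C2_real G" "\<bar>t\<bar> \<le> 1"
  shows "\<bar>G t\<bar> \<le> C2_norm G"
proof -
  have c: "continuous_on UNIV G" "continuous_on UNIV (deriv G)" "continuous_on UNIV (deriv (deriv G))"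
    using assms(1) unfolding C2_real_def
    by (auto intro!: continuous_at_imp_continuous_on field_differentiable_imp_continuous_at)
  have bdd: "bdd_above ((\<lambda>t. \<bar>f t\<bar>) ` {-1..1})" if "continuous_on UNIV f" for f :: "real \<Rightarrow> real"
    using that by (intro compact_imp_bounded[THEN bounded_imp_bdd_above] compact_continuous_image
        continuous_on_rabs continuous_on_subset[OF that]) auto
  have le: "\<bar>f s\<bar> \<le> (SUP t\<in>{-1..1}. \<bar>f t\<bar>)" if "continuous_on UNIV f" "\<bar>s\<bar> \<le> 1" for f :: "real \<Rightarrow> real" and s
    using that by (intro cSUP_upper bdd) auto
  have "0 \<le> (SUP t\<in>{-1..1}. \<bar>f t\<bar>)" if "continuous_on UNIV f" for f :: "real \<Rightarrow> real"
    using le[OF that, of 0] by simp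
  from this[OF c(2)] this[OF c(3)] le[OF c(1) assms(2)] show ?thesis
    unfolding C2_norm_def by linarith
qed

text \<open>\<open>u\<close> is only known to be measurable on the ball. Its extension by zero is
  Lebesgue measurable and agrees with \<open>u\<close> almost everywhere.\<close>

lemma H0_odd_borel_representative:
  fixes u :: "'m::finite pt \<Rightarrow> real"
  assumes "u \<in> H0_odd K R"
  obtains U where "U \<in> borel_measurable borel" "AE x in lborel. u x = U x"
    "\<And>x. x \<notin> ball 0 R \<Longrightarrow> U x = 0"
proof -
  have um: "u \<in> borel_measurable (lebesgue_on (ball 0 R))" and out: "AE x in lborel. x \<notin> ball 0 R \<longrightarrow> u x = 0"
    using assms unfolding H0_odd_def AE_completion_iff by blast+
  have "(\<lambda>x. if x \<in> ball 0 R then u x else 0) \<in> borel_measurable lebesgue"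
    using um by (subst borel_measurable_if) auto
  then obtain U0 where [measurable]: "U0 \<in> borel_measurable borel"
    and U0: "AE x in lborel. (if x \<in> ball 0 R then u x else 0) = U0 x"
    using completion_ex_borel_measurable_real[of _ lborel] by auto
  have [measurable]: "ball (0::'m pt) R \<in> sets borel" by simp
  show ?thesis
  proof
    show "(\<lambda>x. if x \<in> ball 0 R then U0 x else 0) \<in> borel_measurable borel" by measurable
    show "AE x in lborel. u x = (if x \<in> ball 0 R then U0 x else 0)"
      using U0 out by eventually_elim (auto split: if_splits)
  qed auto
qed

theorem theorem1p3:
  fixes \<gamma> lam Lam M :: real
  assumes "0 < \<gamma>" and "\<gamma> < 1" and "0 < lam" and "lam \<le> Lam"
  shows "\<exists>C::real. C > 0 \<and>
    (\<forall>(K :: 'm::finite pt \<Rightarrow> real) (\<kappa> :: real \<Rightarrow> real) (G :: real \<Rightarrow> real) (S :: real) (R :: real)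
        (u :: 'm pt \<Rightarrow> real).
      kernel_L0 \<gamma> lam Lam K \<longrightarrow>
      radial_with_profile K \<kappa> \<longrightarrow>
      strictly_convex_pos (\<lambda>\<tau>. \<kappa> (sqrt \<tau>)) \<longrightarrow>
      C2_real G \<longrightarrow>
      (\<forall>t. G (- t) = G t) \<longrightarrow>
      (\<forall>t. G t \<ge> 0) \<longrightarrow> G 1 = 0 \<longrightarrow> G (- 1) = 0 \<longrightarrow>
      C2_norm G = M \<longrightarrow>
      S \<ge> 2 \<longrightarrow> R > S + 4 \<longrightarrow>
      doubly_radial_odd_minimizer K G R u \<longrightarrow>
      energy K G u (ball 0 S) \<le> ennreal
        (if \<gamma> < 1 / 2 then C * S powr (2 * real CARD('m) - 2 * \<gamma>)
         else if \<gamma> = 1 / 2 then C * S powr (2 * real CARD('m) - 1) * ln S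
         else C * S powr (2 * real CARD('m) - 1)))"
proof -
  let ?n = "2 * CARD('m) - 1"
  define \<Lambda> where "\<Lambda> = Lam * frac_laplacian_const DIM('m pt) \<gamma>"
  have \<Lambda>: "0 < \<Lambda>" unfolding \<Lambda>_def using assms frac_laplacian_const_pos[of \<gamma>] by auto
  obtain C1 where C1: "C1 > 0"
    "\<And>S (k :: 'm pt \<Rightarrow> real). S \<ge> 2 \<Longrightarrow> symmetric_kernel k \<Longrightarrow>
      (\<And>z. k z \<le> \<Lambda> * norm z powr (- real DIM('m pt) - 2 * \<gamma>)) \<Longrightarrow>
      symmetric_kernel.kernel_integral k (transition_weight S) \<le>
        ennreal (C1 * \<Lambda> * S ^ ?n * energy_rate \<gamma> S)"
    using kernel_integral_transition_weight_le[OF assms(1,2), where 'm='m] \<Lambda>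
    by (meson less_imp_le)
  obtain C2 where C2: "C2 > 0" "\<And>S. S \<ge> 2 \<Longrightarrow>
      emeasure lborel (transition_set S (0 :: 'm pt)) \<le> ennreal (C2 * S ^ ?n * min (1 + norm (0 :: 'm pt)) S)"
    using emeasure_transition_set_le[where 'm='m] by blast
  \<comment> \<open>\<open>M\<close> is fixed before \<open>G\<close> and may have any sign, hence
    the absolute value. \<open>36 = 2 * 18\<close> because the potential term is absorbed into the
    rate, which is at least \<open>1/2\<close>.\<close>
  define C where "C = 150 * (C1 * \<Lambda>) + 36 * (\<bar>M\<bar> * C2)"
  have C: "C > 0" unfolding C_def using C1(1) C2(1) \<Lambda> by (intro add_pos_nonneg) auto
  have main: "energy K G u (ball 0 S) \<le> ennreal (C * (S ^ ?n * energy_rate \<gamma> S))"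
    if K: "kernel_L0 \<gamma> lam Lam K" and G: "C2_real G" "\<forall>t. G t \<ge> 0" "G 1 = 0" "G (- 1) = 0" "C2_norm G = M"
      and S: "S \<ge> 2" and R: "R > S + 4" and min: "doubly_radial_odd_minimizer K G R u"
    for K :: "'m pt \<Rightarrow> real" and G S R u
  proof -
    obtain k where k: "k \<in> borel_measurable borel" "\<And>z. 0 \<le> k z" "\<And>z. k (- z) = k z"
      "\<And>z. k z \<le> \<Lambda> * norm z powr (- real DIM('m pt) - 2 * \<gamma>)"
      "AE z in lborel. K z = k z" "AE z in lborel. 0 < k z"
      using kernel_L0_borel_representative[OF K assms] unfolding \<Lambda>_def by blast
    interpret symmetric_kernel k by standard (use k in auto)
    obtain U1 where U1: "U1 \<in> borel_measurable borel" "AE x in lborel. u x = U1 x"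
      "\<And>x. x \<notin> ball 0 R \<Longrightarrow> U1 x = 0"
      using min H0_odd_borel_representative[of u K R] unfolding doubly_radial_odd_minimizer_def by blast
    have contG: "continuous_on UNIV G"
      using G(1) unfolding C2_real_def
      by (auto intro!: continuous_at_imp_continuous_on field_differentiable_imp_continuous_at)
    interpret m1: odd_minimizer k K G R u U1
      by standard (use contG G min k(5) U1 in auto)
    \<comment> \<open>Still equal to \<open>u\<close> almost everywhere, but now bounded by 1 at
      every point, as the pointwise inequalities require.\<close>
    define U where "U x = max (-1) (min 1 (U1 x))" for x
    have "AE x in lborel. u x = U x"
      using U1(2) m1.AE_abs_U_le_1[OF k(6) G(3,4)] by eventually_elim (auto simp: U_def)
    moreover have "U \<in> borel_measurable borel" using U1(1) unfolding U_def[abs_def] by measurable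
    moreover have "U x = 0" if "x \<notin> ball 0 R" for x using U1(3)[OF that] by (simp add: U_def)
    ultimately interpret m2: odd_minimizer k K G R u U
      by unfold_locales (use contG G min k(5) in auto)
    have rate: "1 / 2 \<le> energy_rate \<gamma> S" using energy_rate_ge S assms by blast
    define X where "X = C1 * \<Lambda> * S ^ ?n * energy_rate \<gamma> S"
    define V where "V = C2 * S ^ ?n"
    interpret m3: bounded_odd_minimizer k K G R u U S "\<bar>M\<bar>" X V
    proof unfold_locales
      show "\<bar>U x\<bar> \<le> 1" for x by (simp add: U_def)
      show "G t \<le> \<bar>M\<bar>" if "\<bar>t\<bar> \<le> 1" for t using abs_le_C2_norm[OF G(1) that] G(5) by linarith
      show "kernel_integral (transition_weight S) \<le> ennreal X"
        unfolding X_def using C1(2)[OF S _ k(4)] symmetric_kernel_axioms by blast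
      show "emeasure lborel (transition_set S (0 :: 'm pt)) \<le> ennreal V"
        unfolding V_def using C2(2)[OF S] S by simp
      show "0 \<le> X" "0 \<le> V" unfolding X_def V_def using C1(1) C2(1) \<Lambda> S rate by auto
    qed (use S R G in auto)
    have "18 * (\<bar>M\<bar> * V) * 1 \<le> 18 * (\<bar>M\<bar> * V) * (2 * energy_rate \<gamma> S)"
      using rate m3.V_nonneg by (intro mult_left_mono) auto
    then have "150 * X + 18 * (\<bar>M\<bar> * V) \<le> C * (S ^ ?n * energy_rate \<gamma> S)"
      unfolding X_def V_def C_def by (simp add: algebra_simps)
    then show ?thesis using m3.energy_ball_le ennreal_leI order_trans by blast
  qed
  have rate: "C * (S ^ ?n * energy_rate \<gamma> S) =
      (if \<gamma> < 1 / 2 then C * S powr (2 * real CARD('m) - 2 * \<gamma>)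
       else if \<gamma> = 1 / 2 then C * S powr (2 * real CARD('m) - 1) * ln S
       else C * S powr (2 * real CARD('m) - 1))" if "S \<ge> 2" for S :: real
  proof -
    \<comment> \<open>The natural-number subtraction in \<open>?n\<close> is a true difference
      because \<open>CARD('m)\<close> is positive.\<close>
    have "real ?n = 2 * real CARD('m) - 1" by (subst of_nat_diff) (auto simp: Suc_leI)
    then have n: "S ^ ?n = S powr (2 * real CARD('m) - 1)"
      using that powr_realpow[of S ?n] by simp
    have "S powr (2 * real CARD('m) - 1) * S powr (1 - 2 * \<gamma>) = S powr (2 * real CARD('m) - 2 * \<gamma>)"
      by (simp flip: powr_add)
    then show ?thesis unfolding n energy_rate_def by (simp add: mult.assoc)
  qed
  show ?thesis
  proof (intro exI[of _ C] conjI C allI impI)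
    fix K :: "'m pt \<Rightarrow> real" and \<kappa> G :: "real \<Rightarrow> real" and S R :: real and u :: "'m pt \<Rightarrow> real"
    assume "kernel_L0 \<gamma> lam Lam K" "C2_real G" "\<forall>t. G t \<ge> 0" "G 1 = 0" "G (- 1) = 0" "C2_norm G = M"
      "R > S + 4" "doubly_radial_odd_minimizer K G R u" and S: "S \<ge> 2"
    then show "energy K G u (ball 0 S) \<le> ennreal
        (if \<gamma> < 1 / 2 then C * S powr (2 * real CARD('m) - 2 * \<gamma>)
         else if \<gamma> = 1 / 2 then C * S powr (2 * real CARD('m) - 1) * ln S
         else C * S powr (2 * real CARD('m) - 1))"
      unfolding rate[OF S, symmetric] by (intro main)
  qed
qed

end
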